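(* Let $d\ge 3$ and let $\Omega\subset\mathbb{R}^d$ be a bounded convex set with volume $|\Omega|$ and diameter $\operatorname{diam}(\Omega)$. Then for every $u\in W^{1,1}(\Omega)$, $$\int_{\Omega}|\nabla u|^2\,\mathrm{d}x\left(\int_{\Omega}u^2\,\mathrm{d}x\right)^{2/d}\ \ge\ C_1(\Omega,d)\int_{\Omega}|u-u_\Omega|^{2+4/d}\,\mathrm{d}x,$$ where $u_\Omega=|\Omega|^{-1}\int_\Omega u\,\mathrm{d}x$ and $$C_1(\Omega,d)=\bigl(C_{\rm D}(\Omega,d)\,C_{\rm HLS}(d,d-1,2)\bigr)^{-2},\qquad C_{\rm D}(\Omega,d)=\frac{\operatorname{diam}(\Omega)^d}{d\,|\Omega|}.$$
   Context: $C_{\rm HLS}(n,\lambda,p)$ denotes the sharp constant in the Hardy–Littlewood–Sobolev inequality: for $p,r>1$, $0<\lambda<n$ with $1/p+\lambda/n+1/r=2$, and all $f\in L^p(\mathbb{R}^n)$, $h\in L^r(\mathbb{R}^n)$, $\left|\int_{\mathbb{R}^n}\int_{\mathbb{R}^n} f(x)|x-y|^{-\lambda}h(y)\,\mathrm{d}x\,\mathrm{d}y\right|\le C_{\rm HLS}(n,\lambda,p)\|f\|_p\|h\|_r$. Here $n=d$, $\lambda=d-1$, $p=2$ (so $r=2d/(d+2)$). *)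

theory Defs
  imports "HOL-Analysis.Analysis"
begin

fun C_k :: "nat \<Rightarrow> ('a::euclidean_space \<Rightarrow> real) \<Rightarrow> bool" where
  "C_k 0 f = continuous_on UNIV f"
| "C_k (Suc k) f = (continuous_on UNIV f \<and> (\<forall>x. f differentiable (at x)) \<and>
      (\<forall>i\<in>Basis. C_k k (\<lambda>x. frechet_derivative f (at x) i)))"

definition smooth_fun :: "('a::euclidean_space \<Rightarrow> real) \<Rightarrow> bool" where
  "smooth_fun f \<longleftrightarrow> (\<forall>k. C_k k f)"

definition test_fun :: "'a::euclidean_space set \<Rightarrow> ('a \<Rightarrow> real) \<Rightarrow> bool" where
  "test_fun \<Omega> \<phi> \<longleftrightarrow> smooth_fun \<phi> \<and> compact (closure {x. \<phi> x \<noteq> 0})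
      \<and> closure {x. \<phi> x \<noteq> 0} \<subseteq> interior \<Omega>"

definition W11_with_grad :: "'a::euclidean_space set \<Rightarrow> ('a \<Rightarrow> real) \<Rightarrow> ('a \<Rightarrow> 'a) \<Rightarrow> bool" where
  "W11_with_grad \<Omega> u G \<longleftrightarrow>
     set_integrable lebesgue \<Omega> u \<and>
     (\<forall>i\<in>Basis. set_integrable lebesgue \<Omega> (\<lambda>x. G x \<bullet> i)) \<and>
     (\<forall>\<phi>. test_fun \<Omega> \<phi> \<longrightarrow> (\<forall>i\<in>Basis.
        (LINT x:\<Omega>|lebesgue. u x * frechet_derivative \<phi> (at x) i)
          = - (LINT x:\<Omega>|lebesgue. (G x \<bullet> i) * \<phi> x)))"

definition in_Lp :: "real \<Rightarrow> ('a::euclidean_space \<Rightarrow> real) \<Rightarrow> bool" where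
  "in_Lp q f \<longleftrightarrow> f \<in> borel_measurable lborel \<and> integrable lborel (\<lambda>x. \<bar>f x\<bar> powr q)"

definition Lp_norm :: "real \<Rightarrow> ('a::euclidean_space \<Rightarrow> real) \<Rightarrow> real" where
  "Lp_norm q f = (LINT x|lborel. \<bar>f x\<bar> powr q) powr (1 / q)"

text \<open>Sharp Hardy-Littlewood-Sobolev constant C_HLS(n, lambda, p) with n = DIM('a),
  r determined by 1/p + lambda/n + 1/r = 2.\<close>
definition C_HLS :: "'a::euclidean_space itself \<Rightarrow> real \<Rightarrow> real \<Rightarrow> real" where
  "C_HLS _ lam p =
    (let n = real DIM('a); r = 1 / (2 - 1 / p - lam / n) in
     Inf {C. \<forall>f h :: 'a \<Rightarrow> real. in_Lp p f \<longrightarrow> in_Lp r h \<longrightarrow>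
        \<bar>integral\<^sup>L (lborel \<Otimes>\<^sub>M lborel) (\<lambda>(x, y). f x * norm (x - y) powr (- lam) * h y)\<bar>
          \<le> C * Lp_norm p f * Lp_norm r h})"

definition C_D :: "'a::euclidean_space set \<Rightarrow> real" where
  "C_D \<Omega> = diameter \<Omega> ^ DIM('a) / (real DIM('a) * measure lebesgue \<Omega>)"

definition C_1 :: "'a::euclidean_space set \<Rightarrow> real" where
  "C_1 \<Omega> = (C_D \<Omega> * C_HLS TYPE('a) (real DIM('a) - 1) 2) powr (-2)"

text \<open>Real power (exponent > 0) on extended nonnegative reals, with infinity^r = infinity.\<close>
definition ennpow :: "ennreal \<Rightarrow> real \<Rightarrow> ennreal" where
  "ennpow a r = (if a = \<infinity> then \<infinity> else ennreal (enn2real a powr r))"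

end

theory Submission
  imports Defs
begin

text \<open>
  Testing the weak gradient against smooth bumps that approximate indicators of boxes gives, for every
  vector \<open>h\<close>, the identity \<open>u (y + h) - u y = \<integral>\<^sub>0\<^sup>1 G (y + t h) \<bullet> h dt\<close> for almost every \<open>y\<close> such that \<open>y\<close> and
  \<open>y + h\<close> lie in the interior of \<open>\<Omega>\<close>. Integrating over \<open>h\<close> and substituting \<open>w = t h\<close> bounds the deviation of \<open>u\<close> from its mean by
  \<open>C\<^sub>D\<close> times the Riesz potential \<open>\<integral> |x - w|\<^bsup>1-d\<^esup> |G w| dw\<close>. With \<open>v = u - u\<^sub>\<Omega>\<close>, the Hardy-Littlewood-Sobolev inequality
  applied to \<open>|G|\<close> and \<open>|v|\<^bsup>1+4/d\<^esup>\<close>, followed by Hoelder interpolation between \<open>L\<^sup>2\<close> and \<open>L\<^bsup>2+4/d\<^esup>\<close>, yields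
  \<open>X \<le> C \<parallel>G\<parallel>\<^sub>2 \<parallel>v\<parallel>\<^sub>2\<^bsup>2/d\<^esup> X\<^bsup>1/2\<^esup>\<close> for \<open>X = \<integral> |v|\<^bsup>2+4/d\<^esup>\<close>. Truncating \<open>v\<close> makes \<open>X\<close> finite, so that \<open>X\<^bsup>1/2\<^esup>\<close> can be cancelled.

  Since \<open>C_HLS\<close> is an infimum of real numbers, the Hardy-Littlewood-Sobolev inequality with some finite constant
  has to be proved. Put \<open>A = |f|\<^sup>p\<close>, \<open>B = |h|\<^sup>r\<close>, \<open>D = |x - y|\<^bsup>-n\<^esup>\<close>, normalised so that \<open>\<integral> A = \<integral> B = 1\<close>. The integrand is
  \<open>A\<^sup>\<alpha> B\<^sup>\<beta> D\<^sup>\<gamma>\<close> with exponents in \<open>(0, 1)\<close> of sum 2; comparing \<open>A\<close>, \<open>B\<close> and \<open>D\<close> bounds it pointwise by \<open>A B\<close> plus terms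
  \<open>A\<^bsup>2-s\<^esup> D\<^sup>s\<close> restricted to \<open>D \<ge> A\<close> if \<open>s < 1\<close> and to \<open>D \<le> A\<close> if \<open>s > 1\<close>, and the same with \<open>B\<close>. Integrating such a term
  over one of the two variables leaves a multiple of \<open>A\<close> or \<open>B\<close>.
\<close>

section \<open>Smooth bump functions\<close>

text \<open>\<open>flat 1\<close> is the classical function exp(-1/s) for s > 0, extended by 0. The
  polynomial factor in 1/s makes the family closed under differentiation, so that smoothness follows
  by induction.\<close>

definition flat :: "real poly \<Rightarrow> real \<Rightarrow> real" where
  "flat p s = (if s > 0 then poly p (1 / s) * exp (- (1 / s)) else 0)"

lemma poly_times_exp_minus_tendsto_0:
  fixes p :: "real poly"
  shows "((\<lambda>x. poly p x * exp (- x)) \<longlongrightarrow> 0) at_top"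
proof -
  have "((\<lambda>x. \<Sum>i\<le>degree p. coeff p i * (x ^ i / exp x)) \<longlongrightarrow> (\<Sum>i\<le>degree p. coeff p i * 0)) at_top"
    by (intro tendsto_intros tendsto_power_div_exp_0)
  moreover have "(\<lambda>x. \<Sum>i\<le>degree p. coeff p i * (x ^ i / exp x)) = (\<lambda>x. poly p x * exp (- x))"
    by (auto simp: poly_altdef sum_distrib_right exp_minus divide_inverse mult.assoc)
  ultimately show ?thesis by simp
qed

text \<open>For s > 0 the derivative is s^-2 (p - p')(1/s) exp(-1/s), and \<open>monom 1 2\<close>
  absorbs the factor s^-2. At s = 0 both one-sided difference quotients must be shown to tend to
  0.\<close>

lemma flat_has_real_derivative:
  "(flat p has_real_derivative flat (monom 1 2 * (p - pderiv p)) s) (at s)"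
proof -
  consider "s > 0" | "s < 0" | "s = 0" by linarith
  then show ?thesis
  proof cases
    case 1
    have *: "((\<lambda>s. poly p (1/s) * exp (-(1/s))) has_real_derivative
          flat (monom 1 2 * (p - pderiv p)) s) (at s)"
      using 1 by (auto intro!: derivative_eq_intros simp: flat_def poly_monom field_simps power2_eq_square)
    show ?thesis
      by (rule DERIV_cong_ev[THEN iffD1, OF refl _ refl *])
         (use 1 in \<open>auto simp: flat_def eventually_nhds intro!: exI[of _ "{0<..}"]\<close>)
  next
    case 2
    have *: "((\<lambda>s. 0) has_real_derivative flat (monom 1 2 * (p - pderiv p)) s) (at s)"
      using 2 by (auto simp: flat_def)
    show ?thesis
      by (rule DERIV_cong_ev[THEN iffD1, OF refl _ refl *])
         (use 2 in \<open>auto simp: flat_def eventually_nhds intro!: exI[of _ "{..<0}"]\<close>)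
  next
    case 3
    have r: "((\<lambda>x. flat p x / x) \<longlongrightarrow> 0) (at_right 0)"
    proof -
      \<comment> \<open>\<open>pCons 0 p\<close> is the polynomial X p; evaluated at 1/x, its extra
        factor 1/x is the division in the difference quotient at 0.\<close>
      have "((\<lambda>x. poly (pCons 0 p) (inverse x) * exp (- inverse x)) \<longlongrightarrow> 0) (at_right (0::real))"
        by (rule filterlim_compose[OF poly_times_exp_minus_tendsto_0 filterlim_inverse_at_top_right])
      moreover have "eventually (\<lambda>x. poly (pCons 0 p) (inverse x) * exp (- inverse x) = flat p x / x) (at_right (0::real))"
        by (auto simp: eventually_at_right_field flat_def inverse_eq_divide intro!: exI[of _ 1])
      ultimately show ?thesis by (rule Lim_transform_eventually)
    qed
    have l: "((\<lambda>x. flat p x / x) \<longlongrightarrow> 0) (at_left 0)"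
      by (rule Lim_transform_eventually[OF tendsto_const])
         (auto simp: eventually_at_left_field flat_def intro!: exI[of _ "-1"])
    have "((\<lambda>x. flat p x / x) \<longlongrightarrow> 0) (at 0)"
      using l r by (simp add: filterlim_at_split)
    then show ?thesis using 3 by (simp add: has_field_derivative_iff flat_def)
  qed
qed

section \<open>Closure properties of C^k functions\<close>

lemma C_k_continuous: "C_k k f \<Longrightarrow> continuous_on UNIV f"
  by (cases k) auto

lemma C_k_Suc_D: "C_k (Suc k) f \<Longrightarrow> C_k k f"
proof (induction k arbitrary: f)
  case (Suc k) then show ?case by (metis C_k.simps(2))
qed simp

lemma C_k_const: "C_k k (\<lambda>x::'a::euclidean_space. c)"
  by (induction k arbitrary: c) auto

lemma C_k_add: "C_k k f \<Longrightarrow> C_k k g \<Longrightarrow> C_k k (\<lambda>x. f x + g x)"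
proof (induction k arbitrary: f g)
  case (Suc k)
  then have "frechet_derivative (\<lambda>x. f x + g x) (at x) i
      = frechet_derivative f (at x) i + frechet_derivative g (at x) i" for x i
    by (intro frechet_derivative_at[symmetric, THEN fun_cong] has_derivative_add)
       (auto simp: frechet_derivative_works[symmetric])
  with Suc show ?case by (auto intro!: continuous_intros)
qed (auto intro!: continuous_intros)

lemma C_k_mult: "C_k k f \<Longrightarrow> C_k k g \<Longrightarrow> C_k k (\<lambda>x. f x * g x)"
proof (induction k arbitrary: f g)
  case (Suc k)
  have "frechet_derivative (\<lambda>x. f x * g x) (at x) i
      = f x * frechet_derivative g (at x) i + frechet_derivative f (at x) i * g x" for x i
    by (rule frechet_derivative_at[symmetric, THEN fun_cong], rule has_derivative_mult)
       (use Suc.prems in \<open>auto simp: frechet_derivative_works[symmetric]\<close>)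
  moreover have "C_k k f" "C_k k g"
    using Suc.prems by (blast intro: C_k_Suc_D)+
  ultimately show ?case
    using Suc by (auto intro!: continuous_intros C_k_add)
qed (auto intro!: continuous_intros)

lemma C_k_prod:
  "finite I \<Longrightarrow> (\<And>i. i \<in> I \<Longrightarrow> C_k k (f i)) \<Longrightarrow> C_k k (\<lambda>x. \<Prod>i\<in>I. f i x)"
  by (induction I rule: finite_induct) (auto intro!: C_k_const C_k_mult)

text \<open>A partial derivative in direction i produces the factor \<open>i \<bullet> v\<close> and
  a new polynomial. The scalar \<open>r\<close> and the generalised \<open>p\<close> let the
  induction hypothesis cover exactly this shape.\<close>

lemma C_k_flat_affine: "C_k k (\<lambda>x::'a::euclidean_space. r * flat p (x \<bullet> v + c))"
proof (induction k arbitrary: r p)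
  have D: "((\<lambda>x. r * flat p (x \<bullet> v + c)) has_derivative
       (\<lambda>i. r * (i \<bullet> v * flat (monom 1 2 * (p - pderiv p)) (x \<bullet> v + c)))) (at x)" for x r p
    by (auto intro!: derivative_eq_intros has_derivative_compose[OF _ flat_has_real_derivative[unfolded has_field_derivative_def]] simp: mult_ac)
  have C: "continuous_on UNIV (\<lambda>x. r * flat p (x \<bullet> v + c))" for r p
    by (intro continuous_at_imp_continuous_on ballI has_derivative_continuous[OF D])
  { case 0 show ?case using C by simp }
  { case (Suc k)
    have "frechet_derivative (\<lambda>x. r * flat p (x \<bullet> v + c)) (at x) i
       = (r * (i \<bullet> v)) * flat (monom 1 2 * (p - pderiv p)) (x \<bullet> v + c)" for x i
      by (simp add: frechet_derivative_at[OF D, symmetric])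
    with Suc C D show ?case by (auto simp: differentiable_def intro: D) }
qed

text \<open>As \<^term>\<open>k\<close> tends to infinity, \<^term>\<open>flat 1 (k * s)\<close> tends to the indicator of the
  positive half line, so these test functions exhaust the indicator of a box.\<close>

definition bump :: "real \<Rightarrow> 'a::euclidean_space \<Rightarrow> 'a \<Rightarrow> 'a \<Rightarrow> real" where
  "bump k a b x = (\<Prod>i\<in>Basis. flat 1 (k * (x \<bullet> i - a \<bullet> i)) * flat 1 (k * (b \<bullet> i - x \<bullet> i)))"

lemma C_k_bump: "C_k n (bump k a b)"
proof -
  have "C_k n (\<lambda>x. flat 1 (k * (x \<bullet> i - a \<bullet> i)))" for i
    using C_k_flat_affine[of n 1 1 "k *\<^sub>R i" "- k * (a \<bullet> i)"] by (simp add: algebra_simps)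
  moreover have "C_k n (\<lambda>x. flat 1 (k * (b \<bullet> i - x \<bullet> i)))" for i
    using C_k_flat_affine[of n 1 1 "- k *\<^sub>R i" "k * (b \<bullet> i)"] by (simp add: algebra_simps)
  ultimately show ?thesis
    unfolding bump_def[abs_def] by (intro C_k_prod C_k_mult) auto
qed

lemma flat_1_bounds: "0 \<le> flat 1 s" "flat 1 s \<le> 1"
  by (auto simp: flat_def)

lemma bump_bounds: "0 \<le> bump k a b x" "bump k a b x \<le> 1"
  unfolding bump_def by (auto intro!: prod_nonneg prod_le_1 mult_le_one mult_nonneg_nonneg flat_1_bounds)

lemma bump_eq_0: "k > 0 \<Longrightarrow> x \<notin> box a b \<Longrightarrow> bump k a b x = 0"
  by (force simp: bump_def mem_box flat_def not_less zero_less_mult_iff)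

lemma test_fun_bump:
  assumes "k > 0" "cbox a b \<subseteq> interior \<Omega>"
  shows "test_fun \<Omega> (bump k a b)"
proof -
  have *: "closure {x. bump k a b x \<noteq> 0} \<subseteq> cbox a b"
    by (rule closure_minimal) (use bump_eq_0[OF assms(1)] box_subset_cbox in blast)+
  then have "compact (closure {x. bump k a b x \<noteq> 0})"
    by (meson bounded_cbox bounded_subset closed_closure compact_eq_bounded_closed)
  with * assms C_k_bump show ?thesis
    unfolding test_fun_def smooth_fun_def by blast
qed

lemma bump_translate: "bump k a b (x - w) = bump k (a + w) (b + w) x"
  by (simp add: bump_def inner_diff_left inner_add_left algebra_simps)

lemma bump_tendsto_indicator:
  "(\<lambda>n. bump (real (Suc n)) a b x) \<longlonglongrightarrow> indicator (box a b) x"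
proof (cases "x \<in> box a b")
  case True
  have "(\<lambda>n. flat 1 (real (Suc n) * s)) \<longlonglongrightarrow> 1" if "s > 0" for s
  proof -
    \<comment> \<open>For s > 0 the factor is exp(-1/((n+1) s)), whose exponent tends to 0.\<close>
    have "(\<lambda>n. exp (- (inverse (real (Suc n)) * (1/s)))) \<longlonglongrightarrow> exp (- (0 * (1/s)))"
      by (intro tendsto_intros LIMSEQ_inverse_real_of_nat)
    also have "(\<lambda>n. exp (- (inverse (real (Suc n)) * (1/s)))) = (\<lambda>n. flat 1 (real (Suc n) * s))"
      using that by (intro ext) (simp add: flat_def zero_less_mult_iff divide_inverse mult.commute)
    finally show ?thesis by simp
  qed
  then have "(\<lambda>n. bump (real (Suc n)) a b x) \<longlonglongrightarrow> (\<Prod>i\<in>(Basis::'a set). 1 * 1)"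
    unfolding bump_def using True by (intro tendsto_prod tendsto_mult) (auto simp: mem_box)
  with True show ?thesis by simp
next
  case False then show ?thesis by (simp add: bump_eq_0)
qed

lemma borel_measurable_bump [measurable]: "bump k a b \<in> borel_measurable borel"
  by (intro borel_measurable_continuous_onI C_k_continuous[OF C_k_bump])

section \<open>The Hardy-Littlewood-Sobolev inequality\<close>

lemma nn_integral_lborel_affine:
  fixes f :: "'a::euclidean_space \<Rightarrow> ennreal"
  assumes [measurable]: "f \<in> borel_measurable borel" and "c \<noteq> 0"
  shows "(\<integral>\<^sup>+x. f x \<partial>lborel) = ennreal (\<bar>c\<bar> ^ DIM('a)) * (\<integral>\<^sup>+x. f (t + c *\<^sub>R x) \<partial>lborel)"
  by (subst lborel_affine[OF assms(2), of t])
     (simp add: nn_integral_density nn_integral_distr nn_integral_cmult)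

lemma nn_integral_lborel_translate:
  fixes f :: "'a::euclidean_space \<Rightarrow> ennreal"
  assumes "f \<in> borel_measurable borel"
  shows "(\<integral>\<^sup>+x. f (t + x) \<partial>lborel) = (\<integral>\<^sup>+x. f x \<partial>lborel)"
  using nn_integral_lborel_affine[OF assms, of 1 t] by simp

lemma nn_integral_lborel_reflect:
  fixes f :: "'a::euclidean_space \<Rightarrow> ennreal"
  assumes "f \<in> borel_measurable borel"
  shows "(\<integral>\<^sup>+x. f (t - x) \<partial>lborel) = (\<integral>\<^sup>+x. f x \<partial>lborel)"
  using nn_integral_lborel_affine[OF assms, of "-1" t] by simp

section \<open>Integrals of powers of the norm over balls and their complements\<close>

lemma nn_integral_powr_atLeast:
  assumes "0 < a" "0 < r"
  shows "(\<integral>\<^sup>+t. ennreal (a * t powr (- a - 1)) * indicator {r..} t \<partial>lborel) = ennreal (r powr (- a))"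
proof -
  have "((\<lambda>t. a * t powr (- a - 1)) has_integral (a * (- (r powr (- a - 1 + 1)) / (- a - 1 + 1)))) {r..}"
    using assms by (intro has_integral_mult_right has_integral_powr_to_inf) auto
  from nn_integral_has_integral_lebesgue'[OF _ this] assms show ?thesis by simp
qed

text \<open>For z distinct from 0, |z|^-a is the integral of a t^(-a-1) over t \<ge> |z|; exchanging
  the integrals leaves the volume of the part of \<open>S\<close> in the ball of radius t. At the
  origin \<open>0 powr (- a)\<close> is 0, hence an inequality and no identity pointwise.\<close>

lemma nn_integral_norm_powr_layer_cake:
  fixes S :: "'a::euclidean_space set"
  assumes a: "0 < a" and [measurable]: "S \<in> sets borel"
  shows "(\<integral>\<^sup>+z. ennreal (norm z powr (- a)) * indicator S z \<partial>lborel)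
    \<le> (\<integral>\<^sup>+t. ennreal (a * t powr (- a - 1)) * emeasure lborel (S \<inter> cball 0 t) * indicator {0..} t \<partial>lborel)"
proof -
  have "(\<integral>\<^sup>+z. ennreal (norm z powr (- a)) * indicator S z \<partial>lborel)
      \<le> (\<integral>\<^sup>+z. (\<integral>\<^sup>+t. ennreal (a * t powr (- a - 1)) * indicator {norm z..} t * indicator S z \<partial>lborel) \<partial>lborel)"
  proof (rule nn_integral_mono)
    fix z :: 'a
    show "ennreal (norm z powr (- a)) * indicator S z \<le>
      (\<integral>\<^sup>+t. ennreal (a * t powr (- a - 1)) * indicator {norm z..} t * indicator S z \<partial>lborel)"
    proof (cases "z = 0")
      case False
      then show ?thesis
        by (simp add: nn_integral_multc nn_integral_powr_atLeast[OF a])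
    qed simp
  qed
  also have "\<dots> = (\<integral>\<^sup>+t. (\<integral>\<^sup>+z. ennreal (a * t powr (- a - 1)) * indicator {norm z..} t * indicator S z \<partial>lborel) \<partial>lborel)"
  proof (rule lborel_pair.Fubini'[symmetric])
    have "(\<lambda>(z::'a, t::real). ennreal (a * t powr (- a - 1)) * indicator {norm z..} t * indicator S z) = 
      (\<lambda>p. ennreal (a * snd p powr (- a - 1)) * indicator {p. norm (fst p) \<le> snd p} p * indicator S (fst p))"
      by (auto simp: indicator_def fun_eq_iff)
    also have "\<dots> \<in> borel_measurable (lborel \<Otimes>\<^sub>M lborel)" by measurable
    finally show "(\<lambda>(z::'a, t::real). ennreal (a * t powr (- a - 1)) * indicator {norm z..} t * indicator S z)
       \<in> borel_measurable (lborel \<Otimes>\<^sub>M lborel)" .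
  qed
  also have "\<dots> = (\<integral>\<^sup>+t. ennreal (a * t powr (- a - 1)) * emeasure lborel (S \<inter> cball 0 t) * indicator {0..} t \<partial>lborel)"
  proof (rule nn_integral_cong)
    fix t :: real
    have "(\<integral>\<^sup>+z. ennreal (a * t powr (- a - 1)) * indicator {norm z..} t * indicator S z \<partial>lborel)
      = (\<integral>\<^sup>+z. ennreal (a * t powr (- a - 1)) * indicator (S \<inter> cball 0 t) z \<partial>lborel)"
      by (intro nn_integral_cong) (auto simp: indicator_def)
    also have "\<dots> = ennreal (a * t powr (- a - 1)) * emeasure lborel (S \<inter> cball 0 t)"
      by (subst nn_integral_cmult_indicator) auto
    also have "\<dots> = \<dots> * indicator {0..} t"
      by (cases "t \<ge> 0") (auto simp: indicator_def)
    finally show "(\<integral>\<^sup>+z. ennreal (a * t powr (- a - 1)) * indicator {norm z..} t * indicator S z \<partial>lborel) = \<dots>" .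
  qed
  finally show ?thesis .
qed

text \<open>The intersection of the balls of radii R and t has volume at most V min(t, R)^n.
  Splitting the layer-cake integral at t = R gives a V R^(n-a) / (n-a), finite because a < n, plus V
  R^n R^-a from the tail. These are the two summands of the constant.\<close>

lemma nn_integral_norm_powr_near:
  assumes a: "0 < a" "a < real DIM('a::euclidean_space)"
  obtains K where "0 \<le> K" "\<And>R. 0 < R \<Longrightarrow>
    (\<integral>\<^sup>+z. ennreal (norm z powr (- a)) * indicator (cball (0::'a) R) z \<partial>lborel) \<le> ennreal (K * R powr (real DIM('a) - a))"
proof
  let ?n = "real DIM('a)"
  define V where "V = unit_ball_vol ?n"
  have V: "0 \<le> V" by (simp add: V_def)
  show "0 \<le> a * V / (?n - a) + V" using a V by simp
  fix R :: real assume R: "0 < R"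
  have "(\<integral>\<^sup>+z. ennreal (norm z powr (- a)) * indicator (cball (0::'a) R) z \<partial>lborel)
    \<le> (\<integral>\<^sup>+t. ennreal (a * t powr (- a - 1)) * emeasure lborel (cball (0::'a) R \<inter> cball 0 t) * indicator {0..} t \<partial>lborel)"
    using a by (intro nn_integral_norm_powr_layer_cake) auto
  also have "\<dots> \<le> (\<integral>\<^sup>+t. ennreal (a * V * t powr (?n - a - 1)) * indicator {0..R} t
       + ennreal (V * R ^ DIM('a)) * (ennreal (a * t powr (- a - 1)) * indicator {R..} t) \<partial>lborel)"
  proof (rule nn_integral_mono)
    fix t :: real
    consider "t < 0" | "0 \<le> t" "t \<le> R" | "R < t" by linarith
    then show "ennreal (a * t powr (- a - 1)) * emeasure lborel (cball (0::'a) R \<inter> cball 0 t) * indicator {0..} t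
      \<le> ennreal (a * V * t powr (?n - a - 1)) * indicator {0..R} t
       + ennreal (V * R ^ DIM('a)) * (ennreal (a * t powr (- a - 1)) * indicator {R..} t)"
    proof cases
      case 2
      have "emeasure lborel (cball (0::'a) R \<inter> cball 0 t) \<le> emeasure lborel (cball (0::'a) t)"
        by (rule emeasure_mono) auto
      also have "\<dots> = ennreal (V * t ^ DIM('a))" using 2 by (simp add: emeasure_cball V_def)
      finally have "ennreal (a * t powr (- a - 1)) * emeasure lborel (cball (0::'a) R \<inter> cball 0 t)
         \<le> ennreal (a * t powr (- a - 1)) * ennreal (V * t ^ DIM('a))"
        by (rule mult_left_mono) simp
      also have "\<dots> = ennreal (a * V * (t powr (- a - 1) * t ^ DIM('a)))"
        using a V 2 by (simp add: mult_ac flip: ennreal_mult)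
      also have "t powr (- a - 1) * t ^ DIM('a) = t powr (?n - a - 1)"
      proof (cases "t = 0")
        case False
        then have "t ^ DIM('a) = t powr ?n" using 2 by (simp add: powr_realpow)
        then show ?thesis by (simp flip: powr_add add: algebra_simps)
      qed simp
      finally show ?thesis using 2
        by (simp add: add_increasing2)
    next
      case 3
      have "emeasure lborel (cball (0::'a) R \<inter> cball 0 t) \<le> emeasure lborel (cball (0::'a) R)"
        by (rule emeasure_mono) auto
      also have "\<dots> = ennreal (V * R ^ DIM('a))" using R by (simp add: emeasure_cball V_def)
      finally show ?thesis using 3 R by (simp add: mult.commute[of _ "emeasure _ _"] mult_right_mono)
    qed simp
  qed
  also have "\<dots> = (\<integral>\<^sup>+t. ennreal (a * V * t powr (?n - a - 1)) * indicator {0..R} t \<partial>lborel)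
       + ennreal (V * R ^ DIM('a)) * ennreal (R powr (- a))"
    using a R by (simp add: nn_integral_add nn_integral_cmult nn_integral_powr_atLeast)
  also have "(\<integral>\<^sup>+t. ennreal (a * V * t powr (?n - a - 1)) * indicator {0..R} t \<partial>lborel)
      = ennreal (a * V * (R powr (?n - a - 1 + 1) / (?n - a - 1 + 1)))"
    by (rule nn_integral_has_integral_lebesgue'[OF _ has_integral_mult_right[OF has_integral_powr_from_0]])
       (use a V R in auto)
  also have "ennreal (V * R ^ DIM('a)) * ennreal (R powr (- a)) = ennreal (V * R powr (?n - a))"
    using V R by (simp add: powr_diff powr_minus divide_inverse powr_realpow mult.assoc flip: ennreal_mult')
  also have "ennreal (a * V * (R powr (?n - a - 1 + 1) / (?n - a - 1 + 1))) + ennreal (V * R powr (?n - a))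
     = ennreal ((a * V / (?n - a) + V) * R powr (?n - a))"
    using a V by (simp add: algebra_simps flip: ennreal_plus)
  finally show "(\<integral>\<^sup>+z. ennreal (norm z powr (- a)) * indicator (cball (0::'a) R) z \<partial>lborel)
     \<le> ennreal ((a * V / (?n - a) + V) * R powr (?n - a))" .
qed

text \<open>The layers with t < R are empty, and the others have volume at most V t^n. What remains
  is the integral of a V t^(n-a-1) over t \<ge> R, finite because a > n.\<close>

lemma nn_integral_norm_powr_far:
  assumes a: "real DIM('a::euclidean_space) < a"
  obtains K where "0 \<le> K" "\<And>R. 0 < R \<Longrightarrow>
    (\<integral>\<^sup>+z. ennreal (norm z powr (- a)) * indicator {z::'a. R \<le> norm z} z \<partial>lborel) \<le> ennreal (K * R powr (real DIM('a) - a))"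
proof
  let ?n = "real DIM('a)"
  define V where "V = unit_ball_vol ?n"
  have V: "0 \<le> V" by (simp add: V_def)
  have a0: "0 < a" using a by linarith
  show "0 \<le> a * V / (a - ?n)" using a V a0 by simp
  fix R :: real assume R: "0 < R"
  have "(\<integral>\<^sup>+z. ennreal (norm z powr (- a)) * indicator {z::'a. R \<le> norm z} z \<partial>lborel)
    \<le> (\<integral>\<^sup>+t. ennreal (a * t powr (- a - 1)) * emeasure lborel ({z::'a. R \<le> norm z} \<inter> cball 0 t) * indicator {0..} t \<partial>lborel)"
    using a0 by (intro nn_integral_norm_powr_layer_cake) auto
  also have "\<dots> \<le> (\<integral>\<^sup>+t. ennreal (a * V * t powr (?n - a - 1)) * indicator {R..} t \<partial>lborel)"
  proof (rule nn_integral_mono)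
    fix t :: real
    show "ennreal (a * t powr (- a - 1)) * emeasure lborel ({z::'a. R \<le> norm z} \<inter> cball 0 t) * indicator {0..} t
      \<le> ennreal (a * V * t powr (?n - a - 1)) * indicator {R..} t"
    proof (cases "R \<le> t")
      case True
      have "emeasure lborel ({z::'a. R \<le> norm z} \<inter> cball 0 t) \<le> emeasure lborel (cball (0::'a) t)"
        by (rule emeasure_mono) auto
      also have "\<dots> = ennreal (V * t ^ DIM('a))" using True R by (simp add: emeasure_cball V_def)
      finally have "ennreal (a * t powr (- a - 1)) * emeasure lborel ({z::'a. R \<le> norm z} \<inter> cball 0 t)
         \<le> ennreal (a * t powr (- a - 1)) * ennreal (V * t ^ DIM('a))"
        by (rule mult_left_mono) simp
      also have "\<dots> = ennreal (a * V * (t powr (- a - 1) * t powr ?n))"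
        using a0 V R True by (simp add: mult_ac powr_realpow flip: ennreal_mult')
      also have "t powr (- a - 1) * t powr ?n = t powr (?n - a - 1)"
        by (simp flip: powr_add add: algebra_simps)
      finally show ?thesis using True R by simp
    next
      case False
      then have "{z::'a. R \<le> norm z} \<inter> cball 0 t = {}" by auto
      then show ?thesis by simp
    qed
  qed
  also have "\<dots> = ennreal (a * V * (- (R powr (?n - a - 1 + 1)) / (?n - a - 1 + 1)))"
    by (rule nn_integral_has_integral_lebesgue'[OF _ has_integral_mult_right[OF has_integral_powr_to_inf]])
       (use a a0 V R in auto)
  also have "a * V * (- (R powr (?n - a - 1 + 1)) / (?n - a - 1 + 1)) = a * V / (a - ?n) * R powr (?n - a)"
    using a by (simp add: field_simps)
  finally show "(\<integral>\<^sup>+z. ennreal (norm z powr (- a)) * indicator {z::'a. R \<le> norm z} z \<partial>lborel)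
     \<le> ennreal (a * V / (a - ?n) * R powr (?n - a))" .
qed

text \<open>Apart from the origin, the condition A \<le> |z|^-n describes the ball of radius R =
  A^(-1/n). The kernel integrates there to a multiple of R^(n - n s), as s < 1, and A^(2-s) R^(n - n
  s) = A: the power of A is chosen for this scaling.\<close>

lemma hls_near_integral:
  assumes s: "0 < s" "s < 1"
  obtains K where "0 \<le> K" "\<And>A. 0 \<le> A \<Longrightarrow>
    (\<integral>\<^sup>+z. ennreal (A powr (2 - s) * norm (z::'a::euclidean_space) powr (- (real DIM('a) * s))) *
        indicator {z. A \<le> norm z powr (- real DIM('a))} z \<partial>lborel) \<le> ennreal (K * A)"
proof -
  let ?n = "real DIM('a)"
  have n: "0 < ?n" by simp
  obtain K where K: "0 \<le> K" "\<And>R. 0 < R \<Longrightarrow>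
      (\<integral>\<^sup>+z. ennreal (norm z powr (- (?n * s))) * indicator (cball (0::'a) R) z \<partial>lborel) \<le> ennreal (K * R powr (?n - ?n * s))"
    using nn_integral_norm_powr_near[of "?n * s", where 'a='a] s n by auto
  show ?thesis
  proof (rule that[OF K(1)])
    fix A :: real assume "0 \<le> A"
    show "(\<integral>\<^sup>+z. ennreal (A powr (2 - s) * norm (z::'a) powr (- (?n * s))) *
        indicator {z. A \<le> norm z powr (- ?n)} z \<partial>lborel) \<le> ennreal (K * A)"
    proof (cases "A = 0")
      case False
      with \<open>0 \<le> A\<close> have A: "0 < A" by simp
      define R where "R = A powr (- 1 / ?n)"
      have R: "0 < R" using A by (simp add: R_def)
      have sub: "norm z \<le> R" if "A \<le> norm z powr (- ?n)" for z :: 'a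
      proof -
        have "(norm z powr (- ?n)) powr (- 1 / ?n) \<le> A powr (- 1 / ?n)"
          using that A n by (intro powr_mono2') auto
        then show ?thesis by (simp add: powr_powr R_def)
      qed
      have "(\<integral>\<^sup>+z. ennreal (A powr (2 - s) * norm (z::'a) powr (- (?n * s))) *
          indicator {z. A \<le> norm z powr (- ?n)} z \<partial>lborel)
        \<le> (\<integral>\<^sup>+z. ennreal (A powr (2 - s)) * (ennreal (norm (z::'a) powr (- (?n * s))) * indicator (cball 0 R) z) \<partial>lborel)"
        using sub by (intro nn_integral_mono) (auto simp: indicator_def ennreal_mult')
      also have "\<dots> = ennreal (A powr (2 - s)) * (\<integral>\<^sup>+z. ennreal (norm (z::'a) powr (- (?n * s))) * indicator (cball 0 R) z \<partial>lborel)"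
        by (intro nn_integral_cmult borel_measurable_times_ennreal borel_measurable_indicator) auto
      also have "\<dots> \<le> ennreal (A powr (2 - s)) * ennreal (K * R powr (?n - ?n * s))"
        by (intro mult_left_mono K R) simp
      also have "\<dots> = ennreal (K * (A powr (2 - s) * R powr (?n - ?n * s)))"
        using K(1) by (simp add: mult_ac flip: ennreal_mult')
      also have "A powr (2 - s) * R powr (?n - ?n * s) = A powr (2 - s + (- 1 / ?n) * (?n - ?n * s))"
        by (simp only: R_def powr_powr powr_add)
      also have "2 - s + (- 1 / ?n) * (?n - ?n * s) = 1" by (simp add: field_simps)
      finally show ?thesis using A by simp
    qed (use s in simp)
  qed
qed

text \<open>The same scaling as in \<open>hls_near_integral\<close>, now outside the ball of radius
  A^(-1/n), where s > 1 gives convergence at infinity.\<close>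

lemma hls_far_integral:
  assumes s: "1 < s"
  obtains K where "0 \<le> K" "\<And>A. 0 \<le> A \<Longrightarrow>
    (\<integral>\<^sup>+z. ennreal (A powr (2 - s) * norm (z::'a::euclidean_space) powr (- (real DIM('a) * s))) *
        indicator {z. norm z powr (- real DIM('a)) \<le> A} z \<partial>lborel) \<le> ennreal (K * A)"
proof -
  let ?n = "real DIM('a)"
  have n: "0 < ?n" by simp
  obtain K where K: "0 \<le> K" "\<And>R. 0 < R \<Longrightarrow>
      (\<integral>\<^sup>+z. ennreal (norm z powr (- (?n * s))) * indicator {z::'a. R \<le> norm z} z \<partial>lborel) \<le> ennreal (K * R powr (?n - ?n * s))"
    using nn_integral_norm_powr_far[of "?n * s", where 'a='a] s n by auto
  show ?thesis
  proof (rule that[OF K(1)])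
    fix A :: real assume "0 \<le> A"
    show "(\<integral>\<^sup>+z. ennreal (A powr (2 - s) * norm (z::'a) powr (- (?n * s))) *
        indicator {z. norm z powr (- ?n) \<le> A} z \<partial>lborel) \<le> ennreal (K * A)"
    proof (cases "A = 0")
      case False
      with \<open>0 \<le> A\<close> have A: "0 < A" by simp
      define R where "R = A powr (- 1 / ?n)"
      have R: "0 < R" using A by (simp add: R_def)
      \<comment> \<open>The origin also satisfies the condition, since \<open>0 powr (- ?n)\<close>
        is 0; it is excluded here, and the integrand vanishes there.\<close>
      have sub: "R \<le> norm z" if "norm z powr (- ?n) \<le> A" "z \<noteq> 0" for z :: 'a
      proof -
        have "A powr (- 1 / ?n) \<le> (norm z powr (- ?n)) powr (- 1 / ?n)"
          using that A n by (intro powr_mono2') auto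
        then show ?thesis by (simp add: powr_powr R_def)
      qed
      have "(\<integral>\<^sup>+z. ennreal (A powr (2 - s) * norm (z::'a) powr (- (?n * s))) *
          indicator {z. norm z powr (- ?n) \<le> A} z \<partial>lborel)
        \<le> (\<integral>\<^sup>+z. ennreal (A powr (2 - s)) * (ennreal (norm (z::'a) powr (- (?n * s))) * indicator {z. R \<le> norm z} z) \<partial>lborel)"
      proof (rule nn_integral_mono)
        fix z :: 'a
        show "ennreal (A powr (2 - s) * norm z powr (- (?n * s))) * indicator {z. norm z powr (- ?n) \<le> A} z
          \<le> ennreal (A powr (2 - s)) * (ennreal (norm z powr (- (?n * s))) * indicator {z. R \<le> norm z} z)"
          using sub[of z] by (cases "z = 0") (auto simp: indicator_def ennreal_mult')
      qed
      also have "\<dots> = ennreal (A powr (2 - s)) * (\<integral>\<^sup>+z. ennreal (norm (z::'a) powr (- (?n * s))) * indicator {z. R \<le> norm z} z \<partial>lborel)"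
        by (rule nn_integral_cmult) measurable
      also have "\<dots> \<le> ennreal (A powr (2 - s)) * ennreal (K * R powr (?n - ?n * s))"
        by (intro mult_left_mono K R) simp
      also have "\<dots> = ennreal (K * (A powr (2 - s) * R powr (?n - ?n * s)))"
        using K(1) by (simp add: mult_ac flip: ennreal_mult')
      also have "A powr (2 - s) * R powr (?n - ?n * s) = A powr (2 - s + (- 1 / ?n) * (?n - ?n * s))"
        by (simp only: R_def powr_powr powr_add)
      also have "2 - s + (- 1 / ?n) * (?n - ?n * s) = 1" by (simp add: field_simps)
      finally show ?thesis using A by simp
    qed simp
  qed
qed

section \<open>The inequality with some finite constant\<close>

text \<open>Order the three numbers. If D is smallest, its exponent \<gamma> = (1 - \<alpha>) + (1 -
  \<beta>) is distributed to A and B, giving A B. Otherwise the smallest number is replaced by the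
  middle one, which leaves a product of two powers whose exponents sum to 2.\<close>

lemma hls_pointwise:
  fixes A B D \<alpha> \<beta> \<gamma> :: real
  assumes nn: "0 \<le> A" "0 \<le> B" "0 \<le> D"
    and e: "0 < \<alpha>" "\<alpha> < 1" "0 < \<beta>" "\<beta> < 1" "0 < \<gamma>" "\<gamma> < 1" "\<alpha> + \<beta> + \<gamma> = 2"
  shows "A powr \<alpha> * D powr \<gamma> * B powr \<beta> \<le> A * B
     + A powr (2 - \<gamma>) * D powr \<gamma> * of_bool (A \<le> D)
     + B powr (2 - \<gamma>) * D powr \<gamma> * of_bool (B \<le> D)
     + A powr \<alpha> * D powr (2 - \<alpha>) * of_bool (D \<le> A)
     + B powr \<beta> * D powr (2 - \<beta>) * of_bool (D \<le> B)" (is "?L \<le> ?T1 + ?T2 + ?T3 + ?T4 + ?T5")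
proof -
  have T: "0 \<le> ?T1" "0 \<le> ?T2" "0 \<le> ?T3" "0 \<le> ?T4" "0 \<le> ?T5" using nn by auto
  have sq: "x powr a * x powr b = x powr c" if "a + b = c" for x a b c :: real
    using that by (auto simp flip: powr_add)
  consider "D \<le> A" "D \<le> B" | "A \<le> D" "B \<le> D" "B \<le> A" | "A \<le> D" "B \<le> D" "A \<le> B"
    | "D \<le> A" "B \<le> D" | "A \<le> D" "D \<le> B" by linarith
  then show ?thesis
  proof cases
    case 1
    have "D powr \<gamma> = D powr (1 - \<alpha>) * D powr (1 - \<beta>)" using e by (intro sq[symmetric]) linarith
    also have "\<dots> \<le> A powr (1 - \<alpha>) * B powr (1 - \<beta>)"
      using 1 nn e by (intro mult_mono powr_mono2) auto
    finally have "?L \<le> A powr \<alpha> * (A powr (1 - \<alpha>) * B powr (1 - \<beta>)) * B powr \<beta>"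
      by (intro mult_right_mono mult_left_mono) auto
    also have "\<dots> = (A powr \<alpha> * A powr (1 - \<alpha>)) * (B powr (1 - \<beta>) * B powr \<beta>)" by (simp add: mult_ac)
    also have "\<dots> = A powr 1 * B powr 1" by (simp add: sq del: powr_one)
    also have "\<dots> = ?T1" using nn by simp
    finally show ?thesis using T by linarith
  next
    case 2
    have "?L \<le> A powr \<alpha> * D powr \<gamma> * A powr \<beta>"
      using 2 nn e by (intro mult_left_mono powr_mono2) auto
    also have "\<dots> = (A powr \<alpha> * A powr \<beta>) * D powr \<gamma>" by (simp add: mult_ac)
    also have "\<dots> = A powr (2 - \<gamma>) * D powr \<gamma>" using e by (simp add: sq[of \<alpha> \<beta> "2 - \<gamma>"])
    also have "\<dots> = ?T2" using 2 by simp
    finally show ?thesis using T by linarith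
  next
    case 3
    have "?L \<le> B powr \<alpha> * D powr \<gamma> * B powr \<beta>"
      using 3 nn e by (intro mult_right_mono powr_mono2) auto
    also have "\<dots> = (B powr \<alpha> * B powr \<beta>) * D powr \<gamma>" by (simp add: mult_ac)
    also have "\<dots> = B powr (2 - \<gamma>) * D powr \<gamma>" using e by (simp add: sq[of \<alpha> \<beta> "2 - \<gamma>"])
    also have "\<dots> = ?T3" using 3 by simp
    finally show ?thesis using T by linarith
  next
    case 4
    have "?L \<le> A powr \<alpha> * D powr \<gamma> * D powr \<beta>"
      using 4 nn e by (intro mult_left_mono powr_mono2) auto
    also have "\<dots> = A powr \<alpha> * D powr (2 - \<alpha>)" using e by (simp add: sq[of \<gamma> \<beta> "2 - \<alpha>"] mult.assoc)
    also have "\<dots> = ?T4" using 4 by simp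
    finally show ?thesis using T by linarith
  next
    case 5
    have "?L \<le> D powr \<alpha> * D powr \<gamma> * B powr \<beta>"
      using 5 nn e by (intro mult_right_mono powr_mono2) auto
    also have "\<dots> = B powr \<beta> * D powr (2 - \<beta>)" using e by (simp add: sq[of \<alpha> \<gamma> "2 - \<beta>"] mult.commute)
    also have "\<dots> = ?T5" using 5 by simp
    finally show ?thesis using T by linarith
  qed
qed
lemma hls_nn_integral:
  assumes e: "0 < \<alpha>" "\<alpha> < 1" "0 < \<beta>" "\<beta> < 1" "0 < \<gamma>" "\<gamma> < 1" "\<alpha> + \<beta> + \<gamma> = 2"
  obtains K where "0 \<le> K" "\<And>A B :: 'a::euclidean_space \<Rightarrow> real.
    A \<in> borel_measurable borel \<Longrightarrow> B \<in> borel_measurable borel \<Longrightarrow> (\<And>x. 0 \<le> A x) \<Longrightarrow> (\<And>x. 0 \<le> B x) \<Longrightarrow>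
    (\<integral>\<^sup>+x. ennreal (A x) \<partial>lborel) = 1 \<Longrightarrow> (\<integral>\<^sup>+x. ennreal (B x) \<partial>lborel) = 1 \<Longrightarrow>
    (\<integral>\<^sup>+x. \<integral>\<^sup>+y. ennreal (A x powr \<alpha> * norm (x - y) powr (- (real DIM('a) * \<gamma>)) * B y powr \<beta>) \<partial>lborel \<partial>lborel) \<le> ennreal K"
proof -
  let ?n = "real DIM('a)"
  obtain K1 where K1: "0 \<le> K1" "\<And>A. 0 \<le> A \<Longrightarrow>
    (\<integral>\<^sup>+z. ennreal (A powr (2 - \<gamma>) * norm (z::'a) powr (- (?n * \<gamma>))) * indicator {z. A \<le> norm z powr (- ?n)} z \<partial>lborel) \<le> ennreal (K1 * A)"
    using hls_near_integral[of \<gamma>, where 'a='a] e by auto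
  obtain K2 where K2: "0 \<le> K2" "\<And>A. 0 \<le> A \<Longrightarrow>
    (\<integral>\<^sup>+z. ennreal (A powr (2 - (2 - \<alpha>)) * norm (z::'a) powr (- (?n * (2 - \<alpha>)))) * indicator {z. norm z powr (- ?n) \<le> A} z \<partial>lborel) \<le> ennreal (K2 * A)"
    using hls_far_integral[of "2 - \<alpha>", where 'a='a] e by auto
  obtain K3 where K3: "0 \<le> K3" "\<And>A. 0 \<le> A \<Longrightarrow>
    (\<integral>\<^sup>+z. ennreal (A powr (2 - (2 - \<beta>)) * norm (z::'a) powr (- (?n * (2 - \<beta>)))) * indicator {z. norm z powr (- ?n) \<le> A} z \<partial>lborel) \<le> ennreal (K3 * A)"
    using hls_far_integral[of "2 - \<beta>", where 'a='a] e by auto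
  show ?thesis
  proof (rule that)
    \<comment> \<open>One summand for each of the five terms of \<open>hls_pointwise\<close>; the
      near integral serves both A and B.\<close>
    show "0 \<le> 1 + K1 + K1 + K2 + K3" using K1(1) K2(1) K3(1) by simp
    fix A B :: "'a \<Rightarrow> real"
    assume [measurable]: "A \<in> borel_measurable borel" "B \<in> borel_measurable borel"
      and nn: "\<And>x. 0 \<le> A x" "\<And>x. 0 \<le> B x"
      and one: "(\<integral>\<^sup>+x. ennreal (A x) \<partial>lborel) = 1" "(\<integral>\<^sup>+x. ennreal (B x) \<partial>lborel) = 1"
    define N1 where "N1 = (\<lambda>a z::'a. ennreal (a powr (2 - \<gamma>) * norm z powr (- (?n * \<gamma>))) * indicator {z. a \<le> norm z powr (- ?n)} z)"
    \<comment> \<open>The exponent is left as \<open>2 - (2 - s)\<close> so that the term literally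
      matches \<open>hls_far_integral\<close> at 2 - s, which exceeds 1 for s = \<alpha> and s =
      \<beta>.\<close>
    define N2 where "N2 = (\<lambda>s a (z::'a). ennreal (a powr (2 - (2 - s)) * norm z powr (- (?n * (2 - s)))) * indicator {z. norm z powr (- ?n) \<le> a} z)"
    have [measurable]: "(\<lambda>x. N1 (f x) (g x)) \<in> borel_measurable M" "(\<lambda>x. N2 s (f x) (g x)) \<in> borel_measurable M"
      if [measurable]: "f \<in> borel_measurable M" "g \<in> borel_measurable M" for f g s and M :: "'x measure"
    proof -
      have "(\<lambda>x. N1 (f x) (g x)) = (\<lambda>x. ennreal (f x powr (2 - \<gamma>) * norm (g x) powr (- (?n * \<gamma>))) * (if f x \<le> norm (g x) powr (- ?n) then 1 else 0))"
        by (auto simp: N1_def indicator_def fun_eq_iff)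
      also have "\<dots> \<in> borel_measurable M" by measurable
      finally show "(\<lambda>x. N1 (f x) (g x)) \<in> borel_measurable M" .
      have "(\<lambda>x. N2 s (f x) (g x)) = (\<lambda>x. ennreal (f x powr (2 - (2 - s)) * norm (g x) powr (- (?n * (2 - s)))) * (if norm (g x) powr (- ?n) \<le> f x then 1 else 0))"
        by (auto simp: N2_def indicator_def fun_eq_iff)
      also have "\<dots> \<in> borel_measurable M" by measurable
      finally show "(\<lambda>x. N2 s (f x) (g x)) \<in> borel_measurable M" .
    qed
    have pw: "ennreal (A x powr \<alpha> * norm (x - y) powr (- (?n * \<gamma>)) * B y powr \<beta>)
       \<le> ennreal (A x) * ennreal (B y) + N1 (A x) (x - y) + N1 (B y) (x - y) + N2 \<alpha> (A x) (x - y) + N2 \<beta> (B y) (x - y)" for x y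
    proof -
      let ?D = "norm (x - y) powr (- ?n)"
      have D: "?D powr s = norm (x - y) powr (- (?n * s))" for s by (simp add: powr_powr)
      have "ennreal (A x powr \<alpha> * norm (x - y) powr (- (?n * \<gamma>)) * B y powr \<beta>)
         \<le> ennreal (A x * B y
     + A x powr (2 - \<gamma>) * ?D powr \<gamma> * of_bool (A x \<le> ?D)
     + B y powr (2 - \<gamma>) * ?D powr \<gamma> * of_bool (B y \<le> ?D)
     + A x powr \<alpha> * ?D powr (2 - \<alpha>) * of_bool (?D \<le> A x)
     + B y powr \<beta> * ?D powr (2 - \<beta>) * of_bool (?D \<le> B y))"
        using hls_pointwise[of "A x" "B y" ?D, OF nn(1) nn(2) _ e] by (intro ennreal_leI) (simp add: D)
      also have "\<dots> = ennreal (A x) * ennreal (B y) + N1 (A x) (x - y) + N1 (B y) (x - y) + N2 \<alpha> (A x) (x - y) + N2 \<beta> (B y) (x - y)"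
        unfolding D N1_def N2_def using nn
        by (simp add: ennreal_plus ennreal_mult indicator_def)
      finally show ?thesis .
    qed
    have "(\<integral>\<^sup>+x. \<integral>\<^sup>+y. ennreal (A x powr \<alpha> * norm (x - y) powr (- (?n * \<gamma>)) * B y powr \<beta>) \<partial>lborel \<partial>lborel)
      \<le> (\<integral>\<^sup>+x. \<integral>\<^sup>+y. ennreal (A x) * ennreal (B y) + N1 (A x) (x - y) + N1 (B y) (x - y) + N2 \<alpha> (A x) (x - y) + N2 \<beta> (B y) (x - y) \<partial>lborel \<partial>lborel)"
      by (intro nn_integral_mono pw)
    also have "\<dots> = (\<integral>\<^sup>+x. \<integral>\<^sup>+y. ennreal (A x) * ennreal (B y) \<partial>lborel \<partial>lborel)
       + (\<integral>\<^sup>+x. \<integral>\<^sup>+y. N1 (A x) (x - y) \<partial>lborel \<partial>lborel)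
       + (\<integral>\<^sup>+x. \<integral>\<^sup>+y. N1 (B y) (x - y) \<partial>lborel \<partial>lborel)
       + (\<integral>\<^sup>+x. \<integral>\<^sup>+y. N2 \<alpha> (A x) (x - y) \<partial>lborel \<partial>lborel)
       + (\<integral>\<^sup>+x. \<integral>\<^sup>+y. N2 \<beta> (B y) (x - y) \<partial>lborel \<partial>lborel)"
      by (simp add: nn_integral_add)
    also have "(\<integral>\<^sup>+x. \<integral>\<^sup>+y. ennreal (A x) * ennreal (B y) \<partial>lborel \<partial>lborel) = 1"
      by (simp add: nn_integral_cmult one)
    \<comment> \<open>A term carrying \<open>B y\<close> must be integrated in x first: with y
      fixed, it depends on x only through x - y, and a translation reduces it to the one-variable
      integrals. The terms carrying \<open>A x\<close> are handled by a reflection in y.\<close>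
    also have "(\<integral>\<^sup>+x. \<integral>\<^sup>+y. N1 (B y) (x - y) \<partial>lborel \<partial>lborel) = (\<integral>\<^sup>+y. \<integral>\<^sup>+x. N1 (B y) (x - y) \<partial>lborel \<partial>lborel)"
      by (rule lborel_pair.Fubini'[symmetric]) measurable
    also have "(\<integral>\<^sup>+x. \<integral>\<^sup>+y. N2 \<beta> (B y) (x - y) \<partial>lborel \<partial>lborel) = (\<integral>\<^sup>+y. \<integral>\<^sup>+x. N2 \<beta> (B y) (x - y) \<partial>lborel \<partial>lborel)"
      by (rule lborel_pair.Fubini'[symmetric]) measurable
    also have "(\<integral>\<^sup>+x. \<integral>\<^sup>+y. N1 (A x) (x - y) \<partial>lborel \<partial>lborel) = (\<integral>\<^sup>+x. \<integral>\<^sup>+z. N1 (A x) z \<partial>lborel \<partial>lborel)"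
      by (intro nn_integral_cong nn_integral_lborel_reflect) measurable
    also have "(\<integral>\<^sup>+x. \<integral>\<^sup>+y. N2 \<alpha> (A x) (x - y) \<partial>lborel \<partial>lborel) = (\<integral>\<^sup>+x. \<integral>\<^sup>+z. N2 \<alpha> (A x) z \<partial>lborel \<partial>lborel)"
      by (intro nn_integral_cong nn_integral_lborel_reflect) measurable
    also have "(\<integral>\<^sup>+y. \<integral>\<^sup>+x. N1 (B y) (x - y) \<partial>lborel \<partial>lborel) = (\<integral>\<^sup>+y. \<integral>\<^sup>+z. N1 (B y) z \<partial>lborel \<partial>lborel)"
      using nn_integral_lborel_translate[of "N1 (B y)" "- y" for y] by simp
    also have "(\<integral>\<^sup>+y. \<integral>\<^sup>+x. N2 \<beta> (B y) (x - y) \<partial>lborel \<partial>lborel) = (\<integral>\<^sup>+y. \<integral>\<^sup>+z. N2 \<beta> (B y) z \<partial>lborel \<partial>lborel)"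
      using nn_integral_lborel_translate[of "N2 \<beta> (B y)" "- y" for y] by simp
    also have "1 + (\<integral>\<^sup>+x. \<integral>\<^sup>+z. N1 (A x) z \<partial>lborel \<partial>lborel) + (\<integral>\<^sup>+y. \<integral>\<^sup>+z. N1 (B y) z \<partial>lborel \<partial>lborel)
         + (\<integral>\<^sup>+x. \<integral>\<^sup>+z. N2 \<alpha> (A x) z \<partial>lborel \<partial>lborel) + (\<integral>\<^sup>+y. \<integral>\<^sup>+z. N2 \<beta> (B y) z \<partial>lborel \<partial>lborel)
      \<le> 1 + (\<integral>\<^sup>+x. ennreal (K1 * A x) \<partial>lborel) + (\<integral>\<^sup>+y. ennreal (K1 * B y) \<partial>lborel)
         + (\<integral>\<^sup>+x. ennreal (K2 * A x) \<partial>lborel) + (\<integral>\<^sup>+y. ennreal (K3 * B y) \<partial>lborel)"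
      unfolding N1_def N2_def by (intro add_mono nn_integral_mono K1 K2 K3 nn) simp
    also have "\<dots> = ennreal (1 + K1 + K1 + K2 + K3)"
    proof -
      have "ennreal (1 + K1 + K1 + K2 + K3) = 1 + ennreal K1 + ennreal K1 + ennreal K2 + ennreal K3"
        using K1(1) K2(1) K3(1) by (simp only: ennreal_plus add_nonneg_nonneg zero_le_one ennreal_1)
      then show ?thesis
        using K1(1) K2(1) K3(1) by (simp only: ennreal_mult' nn_integral_cmult one mult_1_right) (simp add: nn_integral_cmult one)
    qed
    finally show "(\<integral>\<^sup>+x. \<integral>\<^sup>+y. ennreal (A x powr \<alpha> * norm (x - y) powr (- (?n * \<gamma>)) * B y powr \<beta>) \<partial>lborel \<partial>lborel)
      \<le> ennreal (1 + K1 + K1 + K2 + K3)" .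
  qed
qed

text \<open>Both sides are homogeneous in f and in h, so |f|^p and |h|^r may be divided by their
  integrals. The normalised estimate then applies with exponents 1/p, 1/r and lam/n, whose sum is 2
  by assumption.\<close>

lemma hardy_littlewood_sobolev:
  assumes p: "1 < p" and lam: "0 < lam" "lam < real DIM('a::euclidean_space)" and r: "1 < r"
    and sum: "1 / p + lam / real DIM('a) + 1 / r = 2"
  obtains K where "0 \<le> K" "\<And>f h :: 'a \<Rightarrow> real. in_Lp p f \<Longrightarrow> in_Lp r h \<Longrightarrow>
    (\<integral>\<^sup>+x. \<integral>\<^sup>+y. ennreal \<bar>f x * norm (x - y) powr (- lam) * h y\<bar> \<partial>lborel \<partial>lborel)
      \<le> ennreal (K * Lp_norm p f * Lp_norm r h)"
proof -
  let ?n = "real DIM('a)"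
  have "0 < ?n" by simp
  then obtain K where K: "0 \<le> K" "\<And>A B :: 'a \<Rightarrow> real.
    A \<in> borel_measurable borel \<Longrightarrow> B \<in> borel_measurable borel \<Longrightarrow> (\<And>x. 0 \<le> A x) \<Longrightarrow> (\<And>x. 0 \<le> B x) \<Longrightarrow>
    (\<integral>\<^sup>+x. ennreal (A x) \<partial>lborel) = 1 \<Longrightarrow> (\<integral>\<^sup>+x. ennreal (B x) \<partial>lborel) = 1 \<Longrightarrow>
    (\<integral>\<^sup>+x. \<integral>\<^sup>+y. ennreal (A x powr (1/p) * norm (x - y) powr (- (?n * (lam / ?n))) * B y powr (1/r)) \<partial>lborel \<partial>lborel) \<le> ennreal K"
    using hls_nn_integral[of "1/p" "1/r" "lam / ?n", where 'a='a] p r lam sum by auto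
  show ?thesis
  proof (rule that[OF K(1)])
    fix f h :: "'a \<Rightarrow> real"
    assume f: "in_Lp p f" and h: "in_Lp r h"
    then have [measurable]: "f \<in> borel_measurable borel" "h \<in> borel_measurable borel"
      by (auto simp: in_Lp_def)
    define I where "I = (\<lambda>q (f::'a \<Rightarrow> real). LINT x|lborel. \<bar>f x\<bar> powr q)"
    have I0: "0 \<le> I q g" for q g by (simp add: I_def)
    have zero: "AE x in lborel. g x = 0" if "in_Lp q g" "I q g = 0" for q g
      using that unfolding in_Lp_def I_def
      by (subst (asm) integral_nonneg_eq_0_iff_AE) auto
    have one: "(\<integral>\<^sup>+x. ennreal (\<bar>g x\<bar> powr q / I q g) \<partial>lborel) = 1" if "in_Lp q g" "I q g \<noteq> 0" for q g
    proof -
      have "(\<integral>\<^sup>+x. ennreal (\<bar>g x\<bar> powr q / I q g) \<partial>lborel) = ennreal (LINT x|lborel. \<bar>g x\<bar> powr q / I q g)"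
        using that I0[of q g] by (intro nn_integral_eq_integral) (auto simp: in_Lp_def)
      also have "(LINT x|lborel. \<bar>g x\<bar> powr q / I q g) = 1"
        using that by (simp add: I_def)
      finally show ?thesis by simp
    qed
    have L: "Lp_norm q g = I q g powr (1/q)" for q g by (simp add: Lp_norm_def I_def)
    \<comment> \<open>Normalisation is impossible when one of the integrals vanishes; that function
      is then zero almost everywhere and the double integral is 0.\<close>
    consider "I p f = 0" | "I r h = 0" | "I p f \<noteq> 0" "I r h \<noteq> 0" by blast
    then show "(\<integral>\<^sup>+x. \<integral>\<^sup>+y. ennreal \<bar>f x * norm (x - y) powr (- lam) * h y\<bar> \<partial>lborel \<partial>lborel)
      \<le> ennreal (K * Lp_norm p f * Lp_norm r h)"
    proof cases
      case 1
      from zero[OF f this] have "AE x in lborel. (\<integral>\<^sup>+y. ennreal \<bar>f x * norm (x - y) powr (- lam) * h y\<bar> \<partial>lborel) = 0"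
        by eventually_elim simp
      then show ?thesis by (subst nn_integral_cong_AE[where v="\<lambda>_. 0"]) auto
    next
      case 2
      have "(\<integral>\<^sup>+y. ennreal \<bar>f x * norm (x - y) powr (- lam) * h y\<bar> \<partial>lborel) = integral\<^sup>N lborel (\<lambda>_::'a. 0)" for x
        by (rule nn_integral_cong_AE, use zero[OF h 2] in eventually_elim) simp
      then show ?thesis by simp
    next
      case 3
      define A where "A = (\<lambda>x. \<bar>f x\<bar> powr p / I p f)"
      define B where "B = (\<lambda>x. \<bar>h x\<bar> powr r / I r h)"
      have [measurable]: "A \<in> borel_measurable borel" "B \<in> borel_measurable borel"
        unfolding A_def B_def by measurable
      have pos: "0 < I p f" "0 < I r h" using 3 I0 by (auto simp: less_le)
      have fA: "\<bar>f x\<bar> = Lp_norm p f * A x powr (1/p)" for x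
        using pos p by (simp add: A_def L powr_divide powr_powr)
      have hB: "\<bar>h x\<bar> = Lp_norm r h * B x powr (1/r)" for x
        using pos r by (simp add: B_def L powr_divide powr_powr)
      have eq: "ennreal \<bar>f x * norm (x - y) powr (- lam) * h y\<bar>
         = ennreal (Lp_norm p f * Lp_norm r h) * ennreal (A x powr (1/p) * norm (x - y) powr (- (?n * (lam / ?n))) * B y powr (1/r))" for x y
        by (simp add: abs_mult fA hB mult_ac L flip: ennreal_mult)
      have "(\<integral>\<^sup>+x. \<integral>\<^sup>+y. ennreal \<bar>f x * norm (x - y) powr (- lam) * h y\<bar> \<partial>lborel \<partial>lborel)
        = ennreal (Lp_norm p f * Lp_norm r h) *
          (\<integral>\<^sup>+x. \<integral>\<^sup>+y. ennreal (A x powr (1/p) * norm (x - y) powr (- (?n * (lam / ?n))) * B y powr (1/r)) \<partial>lborel \<partial>lborel)"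
        unfolding eq by (simp add: nn_integral_cmult)
      also have "\<dots> \<le> ennreal (Lp_norm p f * Lp_norm r h) * ennreal K"
        using pos one[OF f 3(1)] one[OF h 3(2)]
        by (intro mult_left_mono K(2)) (auto simp: A_def[symmetric] B_def[symmetric], auto simp: A_def B_def)
      also have "\<dots> = ennreal (K * Lp_norm p f * Lp_norm r h)"
        using K(1) by (simp add: L mult_ac flip: ennreal_mult)
      finally show ?thesis .
    qed
  qed
qed

section \<open>The inequality with the sharp constant\<close>

text \<open>The finite constant shows that the set of admissible constants is nonempty, so its
  infimum is a genuine greatest lower bound and inherits the estimate. Passing to |f| and |h| turns
  the signed integral of the definition into the nonnegative one bounded here.\<close>

lemma C_HLS_inequality:
  assumes p: "1 < p" and lam: "0 < lam" "lam < real DIM('a::euclidean_space)" and r: "1 < r"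
    and sum: "1 / p + lam / real DIM('a) + 1 / r = 2"
    and f: "in_Lp p f" and h: "in_Lp r (h :: 'a \<Rightarrow> real)"
  shows "(\<integral>\<^sup>+x. \<integral>\<^sup>+y. ennreal \<bar>f x * norm (x - y) powr (- lam) * h y\<bar> \<partial>lborel \<partial>lborel)
      \<le> ennreal (C_HLS TYPE('a) lam p * Lp_norm p f * Lp_norm r h)"
proof -
  let ?F = "\<lambda>f h (x::'a, y). f x * norm (x - y) powr (- lam) * h y"
  define S where "S = {C. \<forall>f h :: 'a \<Rightarrow> real. in_Lp p f \<longrightarrow> in_Lp r h \<longrightarrow>
        \<bar>integral\<^sup>L (lborel \<Otimes>\<^sub>M lborel) (?F f h)\<bar> \<le> C * Lp_norm p f * Lp_norm r h}"
  have "2 - 1 / p - lam / real DIM('a) = 1 / r" using sum by linarith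
  then have "1 / (2 - 1 / p - lam / real DIM('a)) = r" by simp
  then have C: "C_HLS TYPE('a) lam p = Inf S" by (simp add: C_HLS_def S_def Let_def)
  obtain K where K: "0 \<le> K" "\<And>f h :: 'a \<Rightarrow> real. in_Lp p f \<Longrightarrow> in_Lp r h \<Longrightarrow>
    (\<integral>\<^sup>+x. \<integral>\<^sup>+y. ennreal \<bar>f x * norm (x - y) powr (- lam) * h y\<bar> \<partial>lborel \<partial>lborel)
      \<le> ennreal (K * Lp_norm p f * Lp_norm r h)"
    using hardy_littlewood_sobolev[OF p lam r sum] by blast
  have pair: "(\<integral>\<^sup>+z. ennreal (norm (?F f h z)) \<partial>(lborel \<Otimes>\<^sub>M lborel))
       = (\<integral>\<^sup>+x. \<integral>\<^sup>+y. ennreal \<bar>f x * norm (x - y) powr (- lam) * h y\<bar> \<partial>lborel \<partial>lborel)"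
    and meas: "?F f h \<in> borel_measurable (lborel \<Otimes>\<^sub>M lborel)"
    if "in_Lp p f" "in_Lp r h" for f h :: "'a \<Rightarrow> real"
  proof -
    have [measurable]: "f \<in> borel_measurable borel" "h \<in> borel_measurable borel"
      using that by (auto simp: in_Lp_def)
    show "?F f h \<in> borel_measurable (lborel \<Otimes>\<^sub>M lborel)" by measurable
    show "(\<integral>\<^sup>+z. ennreal (norm (?F f h z)) \<partial>(lborel \<Otimes>\<^sub>M lborel))
       = (\<integral>\<^sup>+x. \<integral>\<^sup>+y. ennreal \<bar>f x * norm (x - y) powr (- lam) * h y\<bar> \<partial>lborel \<partial>lborel)"
      by (subst lborel.nn_integral_fst[symmetric]) auto
  qed
  have norm0: "0 \<le> Lp_norm q g" for q and g :: "'a \<Rightarrow> real" by (simp add: Lp_norm_def)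
  have "K \<in> S"
    unfolding S_def
  proof (intro CollectI allI impI)
    fix f h :: "'a \<Rightarrow> real" assume fh: "in_Lp p f" "in_Lp r h"
    \<comment> \<open>If the kernel were not integrable, its Bochner integral would be 0 by default
      and the bound would hold trivially.\<close>
    have "ennreal \<bar>integral\<^sup>L (lborel \<Otimes>\<^sub>M lborel) (?F f h)\<bar> \<le> (\<integral>\<^sup>+z. ennreal (norm (?F f h z)) \<partial>(lborel \<Otimes>\<^sub>M lborel))"
      using integral_norm_bound_ennreal[of "lborel \<Otimes>\<^sub>M lborel" "?F f h"]
      by (cases "integrable (lborel \<Otimes>\<^sub>M lborel) (?F f h)") (auto simp: not_integrable_integral_eq)
    also have "\<dots> \<le> ennreal (K * Lp_norm p f * Lp_norm r h)"
      unfolding pair[OF fh] by (rule K(2)[OF fh])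
    finally show "\<bar>integral\<^sup>L (lborel \<Otimes>\<^sub>M lborel) (?F f h)\<bar> \<le> K * Lp_norm p f * Lp_norm r h"
      using K(1) norm0 by (subst (asm) ennreal_le_iff) auto
  qed
  define af where "af = (\<lambda>x. \<bar>f x\<bar>)"
  define ah where "ah = (\<lambda>x. \<bar>h x\<bar>)"
  have a: "in_Lp p af" "in_Lp r ah" using f h by (auto simp: in_Lp_def af_def ah_def)
  have an: "Lp_norm p af = Lp_norm p f" "Lp_norm r ah = Lp_norm r h" by (simp_all add: Lp_norm_def af_def ah_def)
  have fin: "(\<integral>\<^sup>+x. \<integral>\<^sup>+y. ennreal \<bar>f x * norm (x - y) powr (- lam) * h y\<bar> \<partial>lborel \<partial>lborel)
     = (\<integral>\<^sup>+z. ennreal (?F af ah z) \<partial>(lborel \<Otimes>\<^sub>M lborel))"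
    unfolding pair[OF f h, symmetric] by (intro nn_integral_cong) (auto simp: af_def ah_def abs_mult)
  have "(\<integral>\<^sup>+z. ennreal (norm (?F af ah z)) \<partial>(lborel \<Otimes>\<^sub>M lborel)) < \<infinity>"
    unfolding pair[OF a] using K(2)[OF a] by (rule le_less_trans) simp
  then have "integrable (lborel \<Otimes>\<^sub>M lborel) (?F af ah)"
    using meas[OF a] by (auto simp: integrable_iff_bounded)
  then have I: "(\<integral>\<^sup>+z. ennreal (?F af ah z) \<partial>(lborel \<Otimes>\<^sub>M lborel)) = ennreal (integral\<^sup>L (lborel \<Otimes>\<^sub>M lborel) (?F af ah))"
    by (intro nn_integral_eq_integral) (auto simp: af_def ah_def)
  let ?P = "Lp_norm p f * Lp_norm r h"
  have bd: "integral\<^sup>L (lborel \<Otimes>\<^sub>M lborel) (?F af ah) \<le> C * ?P" if "C \<in> S" for C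
  proof -
    have "\<bar>integral\<^sup>L (lborel \<Otimes>\<^sub>M lborel) (?F af ah)\<bar> \<le> C * Lp_norm p af * Lp_norm r ah"
      using that a unfolding S_def by blast
    then show ?thesis by (simp add: an mult.assoc)
  qed
  have "integral\<^sup>L (lborel \<Otimes>\<^sub>M lborel) (?F af ah) \<le> Inf S * ?P"
  \<comment> \<open>For a positive product of norms one divides by it and compares with every
    admissible constant. For product 0 the constant does not matter, and K alone gives the
    bound.\<close>
  proof (cases "?P = 0")
    case True
    show ?thesis using bd[OF \<open>K \<in> S\<close>] unfolding True by simp
  next
    case False
    then have P: "0 < ?P" using norm0[of p f] norm0[of r h] by (auto simp: less_le)
    have "integral\<^sup>L (lborel \<Otimes>\<^sub>M lborel) (?F af ah) / ?P \<le> Inf S"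
      using bd P \<open>K \<in> S\<close> by (intro cInf_greatest) (auto simp: pos_divide_le_eq)
    then show ?thesis using P by (simp add: pos_divide_le_eq)
  qed
  then show ?thesis
    unfolding fin I C by (intro ennreal_leI) (simp add: mult.assoc)
qed

section \<open>Weak gradients along segments\<close>

text \<open>Within a box whose closure lies in U, the positive and negative parts of F are densities
  of finite measures agreeing on all boxes. Boxes form an intersection-stable generator, so the
  measures and then the densities agree. Countably many closed boxes cover U.\<close>

lemma AE_eq_0_if_box_integrals_0:
  fixes F :: "'a::euclidean_space \<Rightarrow> real"
  assumes F: "integrable lborel F" and "open U"
    and zero: "\<And>c d. cbox c d \<subseteq> U \<Longrightarrow> (LINT y|lborel. indicator (box c d) y * F y) = 0"
  shows "AE y in lborel. y \<in> U \<longrightarrow> F y = 0"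
proof -
  have [measurable]: "F \<in> borel_measurable borel" using F by auto
  have box: "AE y in lborel. y \<in> box a b \<longrightarrow> F y = 0" if ab: "cbox a b \<subseteq> U" for a b
  proof -
    define P where "P = (\<lambda>y. max 0 (F y) * indicator (box a b) y)"
    define N where "N = (\<lambda>y. max 0 (- F y) * indicator (box a b) y)"
    have iP: "integrable lborel P"
      unfolding P_def by (rule Bochner_Integration.integrable_bound[OF F]) (auto simp: indicator_def intro!: AE_I2)
    have iN: "integrable lborel N"
      unfolding N_def by (rule Bochner_Integration.integrable_bound[OF F]) (auto simp: indicator_def intro!: AE_I2)
    have [measurable]: "P \<in> borel_measurable borel" "N \<in> borel_measurable borel" using iP iN by auto
    have nn: "0 \<le> P y" "0 \<le> N y" for y by (auto simp: P_def N_def)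
    have eq: "emeasure (density lborel (\<lambda>y. ennreal (P y))) (box c d) = emeasure (density lborel (\<lambda>y. ennreal (N y))) (box c d)" for c d
    proof -
      have *: "emeasure (density lborel (\<lambda>y. ennreal (Q y))) (box c d) = ennreal (LINT y|lborel. indicator (box c d) y * Q y)"
        if Q: "integrable lborel Q" "\<And>y. 0 \<le> Q y" for Q
      proof -
        have [measurable]: "Q \<in> borel_measurable borel" using Q by auto
        have "emeasure (density lborel (\<lambda>y. ennreal (Q y))) (box c d) = (\<integral>\<^sup>+y. ennreal (indicator (box c d) y * Q y) \<partial>lborel)"
          by (subst emeasure_density) (auto intro!: nn_integral_cong simp: indicator_def)
        also have "\<dots> = ennreal (LINT y|lborel. indicator (box c d) y * Q y)"
          by (rule nn_integral_eq_integral, rule Bochner_Integration.integrable_bound[OF Q(1)])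
             (simp_all add: Q indicator_def)
        finally show ?thesis .
      qed
      obtain e f where ef: "box c d \<inter> box a b = box e f" using box_Int_box[of c d a b] by blast
      have "(LINT y|lborel. indicator (box e f) y * F y) = 0"
      \<comment> \<open>A nonempty open box has the corresponding closed box as closure, which puts
        \<open>cbox e f\<close> inside U. For an empty open box, \<open>cbox e f\<close> may be a
        degenerate box elsewhere, but the integral is 0.\<close>
      proof (cases "box e f = {}")
        case False
        have "box e f \<subseteq> cbox a b" using ef box_subset_cbox by blast
        then have "closure (box e f) \<subseteq> cbox a b" by (rule closure_minimal) (rule closed_cbox)
        then have "cbox e f \<subseteq> cbox a b" using closure_box[OF False] by simp
        with ab show ?thesis by (intro zero) auto
      qed simp
      also have "(LINT y|lborel. indicator (box e f) y * F y) = (LINT y|lborel. indicator (box c d) y * P y - indicator (box c d) y * N y)"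
        unfolding ef[symmetric]
        by (rule Bochner_Integration.integral_cong[OF refl]) (simp add: P_def N_def indicator_def max_def)
      also have "\<dots> = (LINT y|lborel. indicator (box c d) y * P y) - (LINT y|lborel. indicator (box c d) y * N y)"
        by (rule Bochner_Integration.integral_diff; rule Bochner_Integration.integrable_bound, (rule iP iN), simp, simp add: indicator_def)
      finally show ?thesis by (simp add: * iP iN nn)
    qed
    have fin: "(\<integral>\<^sup>+y. ennreal (P y) \<partial>lborel) \<noteq> \<infinity>"
      using iP nn by (subst nn_integral_eq_integral) auto
    have "density lborel (\<lambda>y. ennreal (P y)) = density lborel (\<lambda>y. ennreal (N y))"
    proof (rule measure_eqI_generator_eq)
      let ?E = "range (\<lambda>(a, b). box a b::'a set)"
      show "Int_stable ?E" by (auto simp: Int_stable_def box_Int_box)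
      show "?E \<subseteq> Pow UNIV" "sets (density lborel (\<lambda>y. ennreal (P y))) = sigma_sets UNIV ?E"
        "sets (density lborel (\<lambda>y. ennreal (N y))) = sigma_sets UNIV ?E"
        by (simp_all add: borel_eq_box)
      let ?A = "\<lambda>n::nat. box (- (real n *\<^sub>R One)) (real n *\<^sub>R One) :: 'a set"
      show "range ?A \<subseteq> ?E" "(\<Union>i. ?A i) = UNIV"
        unfolding UN_box_eq_UNIV by auto
      show "emeasure (density lborel (\<lambda>y. ennreal (P y))) (?A i) \<noteq> \<infinity>" for i
      proof -
        have "emeasure (density lborel (\<lambda>y. ennreal (P y))) (?A i) \<le> (\<integral>\<^sup>+y. ennreal (P y) \<partial>lborel)"
          by (subst emeasure_density) (auto intro!: nn_integral_mono simp: indicator_def)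
        with fin show ?thesis by (auto simp: top_unique)
      qed
      show "emeasure (density lborel (\<lambda>y. ennreal (P y))) X = emeasure (density lborel (\<lambda>y. ennreal (N y))) X" if "X \<in> ?E" for X
        using that eq by auto
    qed
    then have "AE y in lborel. ennreal (P y) = ennreal (N y)"
      by (rule finite_density_unique[THEN iffD1, rotated -1]) (use fin in auto)
    then show ?thesis
    proof eventually_elim
      case (elim y)
      then have "P y = N y" using nn by simp
      then show ?case by (cases "F y \<le> 0") (auto simp: P_def N_def)
    qed
  qed
  obtain D where D: "countable D" "D \<subseteq> Pow U" "\<And>X. X \<in> D \<Longrightarrow> \<exists>a b. X = cbox a b" "\<Union>D = U"
    using open_countable_Union_open_cbox[OF \<open>open U\<close>] by metis
  have cb: "AE y in lborel. y \<in> X \<longrightarrow> F y = 0" if "X \<in> D" for X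
  proof -
    obtain a b where X: "X = cbox a b" using D(3) \<open>X \<in> D\<close> by blast
    have "cbox a b - box a b \<in> null_sets lborel"
    proof (rule null_setsI)
      have "emeasure lborel (cbox a b - box a b) = emeasure lborel (cbox a b) - emeasure lborel (box a b)"
        by (rule emeasure_Diff) (use box_subset_cbox in \<open>auto simp: emeasure_lborel_box_eq\<close>)
      also have "emeasure lborel (cbox a b) = emeasure lborel (box a b)"
        by (simp only: emeasure_lborel_box_eq emeasure_lborel_cbox_eq)
      finally show "emeasure lborel (cbox a b - box a b) = 0" by (simp add: emeasure_lborel_box_eq)
    qed simp
    then have "AE y in lborel. y \<notin> cbox a b - box a b" by (rule AE_not_in)
    moreover have "AE y in lborel. y \<in> box a b \<longrightarrow> F y = 0"
      using D(2) \<open>X \<in> D\<close> X by (intro box) auto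
    ultimately show ?thesis by eventually_elim (auto simp: X)
  qed
  have "AE y in lborel. \<forall>X\<in>D. y \<in> X \<longrightarrow> F y = 0"
    using D(1) cb by (subst AE_ball_countable) auto
  then show ?thesis by eventually_elim (use D(4) in auto)
qed

section \<open>Difference quotients tested against bumps\<close>

lemma integrable_lborel_translate:
  fixes f :: "'a::euclidean_space \<Rightarrow> 'b::{banach, second_countable_topology}"
  assumes "integrable lborel f"
  shows "integrable lborel (\<lambda>x. f (x + t))"
proof -
  have "integrable (distr lborel borel ((+) t)) f" using assms by (simp add: lborel_distr_plus)
  then show ?thesis by (subst (asm) integrable_distr_eq) (use assms in \<open>auto simp: add.commute\<close>)
qed

lemma integral_lborel_translate:
  fixes f :: "'a::euclidean_space \<Rightarrow> 'b::{banach, second_countable_topology}"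
  assumes "f \<in> borel_measurable borel"
  shows "(LINT x|lborel. f (x + t)) = (LINT x|lborel. f x)"
proof -
  have "(LINT x|lborel. f x) = (LINT x|distr lborel borel ((+) t). f x)" by (simp add: lborel_distr_plus)
  also have "\<dots> = (LINT x|lborel. f (t + x))" using assms by (subst integral_distr) auto
  finally show ?thesis by (simp add: add.commute)
qed

lemma integrable_lborel_pairI:
  fixes f :: "'a::euclidean_space \<Rightarrow> 'b::euclidean_space \<Rightarrow> real"
  assumes "(\<lambda>(x, y). f x y) \<in> borel_measurable (lborel \<Otimes>\<^sub>M lborel)"
    and "(\<integral>\<^sup>+x. \<integral>\<^sup>+y. ennreal \<bar>f x y\<bar> \<partial>lborel \<partial>lborel) < \<infinity>"
  shows "integrable (lborel \<Otimes>\<^sub>M lborel) (\<lambda>(x, y). f x y)"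
proof (rule integrableI_bounded)
  have "(\<integral>\<^sup>+z. ennreal (norm (case z of (x, y) \<Rightarrow> f x y)) \<partial>(lborel \<Otimes>\<^sub>M lborel))
     = (\<integral>\<^sup>+x. \<integral>\<^sup>+y. ennreal \<bar>f x y\<bar> \<partial>lborel \<partial>lborel)"
    using assms(1) by (subst lborel.nn_integral_fst[symmetric]) auto
  then show "(\<integral>\<^sup>+z. ennreal (norm (case z of (x, y) \<Rightarrow> f x y)) \<partial>(lborel \<Otimes>\<^sub>M lborel)) < \<infinity>"
    using assms(2) by simp
qed fact

lemma frechet_derivative_C_k:
  assumes "C_k (Suc 0) f"
  shows "(f has_derivative frechet_derivative f (at x)) (at x)"
    and "frechet_derivative f (at x) h = (\<Sum>i\<in>Basis. (h \<bullet> i) * frechet_derivative f (at x) i)"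
    and "continuous_on UNIV (\<lambda>x. frechet_derivative f (at x) h)"
proof -
  show D: "(f has_derivative frechet_derivative f (at x)) (at x)" for x
    using assms by (simp add: frechet_derivative_works[symmetric])
  show eq: "frechet_derivative f (at x) h = (\<Sum>i\<in>Basis. (h \<bullet> i) * frechet_derivative f (at x) i)" for x
  proof -
    have lin: "linear (frechet_derivative f (at x))" using D by (rule has_derivative_linear)
    have "frechet_derivative f (at x) h = frechet_derivative f (at x) (\<Sum>i\<in>Basis. (h \<bullet> i) *\<^sub>R i)"
      by (simp only: euclidean_representation)
    also have "\<dots> = (\<Sum>i\<in>Basis. (h \<bullet> i) * frechet_derivative f (at x) i)"
      by (subst linear_sum[OF lin]) (simp add: linear_scale[OF lin])
    finally show ?thesis .
  qed
  show "continuous_on UNIV (\<lambda>x. frechet_derivative f (at x) h)"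
    unfolding eq by (intro continuous_on_sum continuous_on_mult_left) (use assms in simp)
qed

text \<open>The derivative is continuous on the compact box and vanishes on its open complement,
  where the bump is identically 0.\<close>

lemma frechet_derivative_bump_bounded:
  assumes "0 < k"
  obtains M where "0 \<le> M" "\<And>x. \<bar>frechet_derivative (bump k a b) (at x) h\<bar> \<le> M"
proof -
  let ?D = "\<lambda>x. frechet_derivative (bump k a b) (at x) h"
  have "compact (?D ` cbox a b)"
    using frechet_derivative_C_k(3)[OF C_k_bump[of "Suc 0"], of k a b h]
    by (intro compact_continuous_image) (auto intro: continuous_on_subset)
  then have "bounded (?D ` cbox a b)" by (rule compact_imp_bounded)
  then obtain M where M: "\<And>x. x \<in> cbox a b \<Longrightarrow> \<bar>?D x\<bar> \<le> M"
    unfolding bounded_iff real_norm_def by blast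
  have z: "bump k a b y = 0" if "y \<notin> cbox a b" for y
    using bump_eq_0[OF assms] box_subset_cbox that by blast
  have "?D x = 0" if "x \<notin> cbox a b" for x
  proof -
    have "((\<lambda>_. 0) has_derivative (\<lambda>_. 0)) (at x)" by simp
    then have "(bump k a b has_derivative (\<lambda>_. 0)) (at x)"
      by (rule has_derivative_transform_within_open[of _ _ _ _ "- cbox a b"])
         (use that z in auto)
    then show ?thesis by (simp add: frechet_derivative_at[symmetric])
  qed
  then have "\<bar>?D x\<bar> \<le> max 0 M" for x using M[of x] by (cases "x \<in> cbox a b") auto
  then show ?thesis using that[of "max 0 M"] by auto
qed

text \<open>The fundamental theorem of calculus is applied to the smooth bump, not to u: \<phi>(y -
  h) - \<phi>(y) is the integral over t in [0, 1] of minus the derivative along h at y - t h. For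
  each t the shifted bump is a legitimate test function, so the weak identity moves the derivative
  onto u.\<close>

lemma weak_derivative_ftc_bump:
  fixes u :: "'a::euclidean_space \<Rightarrow> real" and G :: "'a \<Rightarrow> 'a"
  assumes W: "open W" "convex W"
    and u: "integrable lborel u" and G: "integrable lborel G"
    and weak: "\<And>\<phi> i. test_fun W \<phi> \<Longrightarrow> i \<in> Basis \<Longrightarrow>
       (LINT x|lborel. u x * frechet_derivative \<phi> (at x) i) = - (LINT x|lborel. (G x \<bullet> i) * \<phi> x)"
    and k: "0 < k" and ab: "cbox a b \<subseteq> W" "cbox (a + h) (b + h) \<subseteq> W"
  shows "(LINT y|lborel. u y * (bump k a b (y - h) - bump k a b y)) =
     (LINT t|lborel. indicator {0..1} t * (LINT y|lborel. (G y \<bullet> h) * bump k a b (y - t *\<^sub>R h)))"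
proof -
  have [measurable]: "u \<in> borel_measurable borel" "G \<in> borel_measurable borel" using u G by auto
  define D where "D = (\<lambda>x. frechet_derivative (bump k a b) (at x) h)"
  have contD: "continuous_on UNIV D"
    unfolding D_def by (rule frechet_derivative_C_k[OF C_k_bump])
  then have [measurable]: "D \<in> borel_measurable borel" by (rule borel_measurable_continuous_onI)
  obtain M where M: "0 \<le> M" "\<And>x. \<bar>D x\<bar> \<le> M"
    unfolding D_def using frechet_derivative_bump_bounded[OF k] by blast
  have ftc: "bump k a b (y - h) - bump k a b y = (LINT t|lborel. indicator {0..1} t * (- D (y - t *\<^sub>R h)))" for y
  proof -
    have "((\<lambda>t. bump k a b (y - t *\<^sub>R h)) has_vector_derivative - D (y - t *\<^sub>R h)) (at t within {0..1})" for t
    proof -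
      have l: "linear (frechet_derivative (bump k a b) (at x))" for x
        using frechet_derivative_C_k(1)[OF C_k_bump[of "Suc 0"]] by (rule has_derivative_linear)
      have "((\<lambda>t. bump k a b (y - t *\<^sub>R h)) has_derivative
         (\<lambda>s. frechet_derivative (bump k a b) (at (y - t *\<^sub>R h)) (- (s *\<^sub>R h)))) (at t within {0..1})"
        by (rule has_derivative_compose[OF _ frechet_derivative_C_k(1)[OF C_k_bump[of "Suc 0"]]])
           (auto intro!: derivative_eq_intros)
      then show ?thesis
        by (simp add: has_vector_derivative_def D_def linear_neg[OF l] linear_scale[OF l])
    qed
    moreover have "continuous_on {0..1} (\<lambda>t. - D (y - t *\<^sub>R h))"
      by (intro continuous_intros continuous_on_compose2[OF contD]) auto
    ultimately have "(LINT t|lborel. indicator {0..1} t *\<^sub>R (- D (y - t *\<^sub>R h))) = bump k a b (y - 1 *\<^sub>R h) - bump k a b (y - 0 *\<^sub>R h)"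
      by (intro integral_FTC_atLeastAtMost) auto
    then show ?thesis by simp
  qed
  have inner: "(LINT y|lborel. u y * D (y - t *\<^sub>R h)) = - (LINT y|lborel. (G y \<bullet> h) * bump k a b (y - t *\<^sub>R h))"
    if t: "t \<in> {0..1}" for t
  proof -
    define \<phi> where "\<phi> = bump k (a + t *\<^sub>R h) (b + t *\<^sub>R h)"
    have \<phi>: "\<phi> y = bump k a b (y - t *\<^sub>R h)" for y by (simp add: \<phi>_def bump_translate)
    \<comment> \<open>Each point of the intermediate box lies on a segment joining y in the first
      box to y + h in the last; convexity of W keeps it in W.\<close>
    have "cbox (a + t *\<^sub>R h) (b + t *\<^sub>R h) \<subseteq> W"
    proof
      fix z assume z: "z \<in> cbox (a + t *\<^sub>R h) (b + t *\<^sub>R h)"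
      define y where "y = z - t *\<^sub>R h"
      have "y \<in> cbox a b" "y + h \<in> cbox (a + h) (b + h)"
        using z by (auto simp: y_def mem_box inner_diff_left inner_add_left algebra_simps)
      then have "y \<in> W" "y + h \<in> W" using ab by auto
      then have "(1 - t) *\<^sub>R y + t *\<^sub>R (y + h) \<in> W"
        using t by (intro convexD[OF W(2)]) auto
      then show "z \<in> W" by (simp add: y_def algebra_simps)
    qed
    then have test: "test_fun W \<phi>"
      unfolding \<phi>_def using W k by (intro test_fun_bump) (auto simp: interior_open)
    have "frechet_derivative \<phi> (at y) h = D (y - t *\<^sub>R h)" for y
    proof -
      have "((\<lambda>y. bump k a b (y - t *\<^sub>R h)) has_derivative
         (\<lambda>s. frechet_derivative (bump k a b) (at (y - t *\<^sub>R h)) s)) (at y)"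
        by (rule has_derivative_compose[OF _ frechet_derivative_C_k(1)[OF C_k_bump[of "Suc 0"]]])
           (auto intro!: derivative_eq_intros)
      then have "(\<phi> has_derivative frechet_derivative (bump k a b) (at (y - t *\<^sub>R h))) (at y)"
        by (simp add: \<phi>[abs_def])
      then show ?thesis by (simp add: D_def frechet_derivative_at[symmetric])
    qed
    then have Deq: "D (y - t *\<^sub>R h) = (\<Sum>i\<in>Basis. (h \<bullet> i) * frechet_derivative \<phi> (at y) i)" for y
      using frechet_derivative_C_k(2)[OF C_k_bump[of "Suc 0"], of k "a + t *\<^sub>R h" "b + t *\<^sub>R h" y h]
      by (simp add: \<phi>_def)
    have i1: "integrable lborel (\<lambda>y. u y * frechet_derivative \<phi> (at y) i)" for i
    proof -
      obtain M where M: "\<And>x. \<bar>frechet_derivative \<phi> (at x) i\<bar> \<le> M"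
        unfolding \<phi>_def using frechet_derivative_bump_bounded[OF k] by blast
      have [measurable]: "(\<lambda>y. frechet_derivative \<phi> (at y) i) \<in> borel_measurable borel"
        unfolding \<phi>_def by (intro borel_measurable_continuous_onI frechet_derivative_C_k[OF C_k_bump])
      show ?thesis
      proof (rule Bochner_Integration.integrable_bound[of _ "\<lambda>y. M * u y"])
        have "\<bar>frechet_derivative \<phi> (at x) i\<bar> \<le> \<bar>M\<bar>" for x using M[of x] by linarith
        then show "AE y in lborel. norm (u y * frechet_derivative \<phi> (at y) i) \<le> norm (M * u y)"
          by (intro AE_I2) (simp add: abs_mult mult.commute[of "\<bar>u _\<bar>"] mult_right_mono)
      qed (use u in auto)
    qed
    have [measurable]: "\<phi> \<in> borel_measurable borel" by (simp add: \<phi>_def)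
    have i2: "integrable lborel (\<lambda>y. (G y \<bullet> i) * \<phi> y)" for i
    proof (rule Bochner_Integration.integrable_bound[of _ "\<lambda>y. G y \<bullet> i"])
      show "AE y in lborel. norm ((G y \<bullet> i) * \<phi> y) \<le> norm (G y \<bullet> i)"
        by (auto simp: abs_mult bump_bounds \<phi>_def intro!: AE_I2 mult_right_le_one_le)
    qed (use G in auto)
    have "(LINT y|lborel. u y * D (y - t *\<^sub>R h)) = (LINT y|lborel. (\<Sum>i\<in>Basis. (h \<bullet> i) * (u y * frechet_derivative \<phi> (at y) i)))"
      by (simp add: Deq sum_distrib_left mult_ac)
    also have "\<dots> = (\<Sum>i\<in>Basis. (h \<bullet> i) * (LINT y|lborel. u y * frechet_derivative \<phi> (at y) i))"
      using i1 by simp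
    also have "\<dots> = (\<Sum>i\<in>Basis. (h \<bullet> i) * (- (LINT y|lborel. (G y \<bullet> i) * \<phi> y)))"
      by (intro sum.cong refl arg_cong2[where f="(*)"] weak test)
    also have "\<dots> = - (LINT y|lborel. (\<Sum>i\<in>Basis. (h \<bullet> i) * ((G y \<bullet> i) * \<phi> y)))"
      using i2 by (simp add: sum_negf)
    also have "(\<lambda>y. (\<Sum>i\<in>Basis. (h \<bullet> i) * ((G y \<bullet> i) * \<phi> y))) = (\<lambda>y. (G y \<bullet> h) * \<phi> y)"
      by (simp add: euclidean_inner[of _ h] sum_distrib_right sum_distrib_left mult_ac)
    finally show ?thesis by (simp add: \<phi>)
  qed
  have "(LINT y|lborel. u y * (bump k a b (y - h) - bump k a b y))
      = (LINT y|lborel. LINT t|lborel. indicator {0..1} t * (u y * (- D (y - t *\<^sub>R h))))"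
    unfolding ftc
    by (subst integral_mult_right_zero[symmetric]) (simp only: mult.left_commute)
  \<comment> \<open>The exchange is justified by the majorant M |u| on the unit interval, with M
    bounding the derivative of the bump.\<close>
  also have "\<dots> = (LINT t|lborel. LINT y|lborel. indicator {0..1} t * (u y * (- D (y - t *\<^sub>R h))))"
  proof (rule lborel_pair.Fubini_integral, rule integrable_lborel_pairI)
    show "(\<lambda>(t::real, y). indicator {0..1} t * (u y * - D (y - t *\<^sub>R h))) \<in> borel_measurable (lborel \<Otimes>\<^sub>M lborel)"
      by measurable
    have "(\<integral>\<^sup>+t. \<integral>\<^sup>+y. ennreal \<bar>indicator {0..1::real} t * (u y * - D (y - t *\<^sub>R h))\<bar> \<partial>lborel \<partial>lborel)
       \<le> (\<integral>\<^sup>+t. \<integral>\<^sup>+y. indicator {0..1::real} t * ennreal (M * \<bar>u y\<bar>) \<partial>lborel \<partial>lborel)"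
      using M by (intro nn_integral_mono)
         (auto simp: indicator_def abs_mult mult.commute[of M] intro!: ennreal_leI mult_left_mono)
    also have "\<dots> = (\<integral>\<^sup>+y. ennreal (M * \<bar>u y\<bar>) \<partial>lborel)"
      by (simp add: nn_integral_cmult nn_integral_multc)
    also have "\<dots> < \<infinity>"
      using u M by (subst nn_integral_eq_integral) auto
    finally show "(\<integral>\<^sup>+t. \<integral>\<^sup>+y. ennreal \<bar>indicator {0..1::real} t * (u y * - D (y - t *\<^sub>R h))\<bar> \<partial>lborel \<partial>lborel) < \<infinity>" .
  qed
  also have "\<dots> = (LINT t|lborel. indicator {0..1} t * (LINT y|lborel. (G y \<bullet> h) * bump k a b (y - t *\<^sub>R h)))"
    using inner by (intro Bochner_Integration.integral_cong) (auto simp: indicator_def)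
  finally show ?thesis .
qed

text \<open>Translating variables in \<open>weak_derivative_ftc_bump\<close> shows that the defect
  \<open>F\<close> integrates to 0 against every bump over an admissible box. Letting the bumps
  increase to indicators gives vanishing box integrals, hence F = 0 almost everywhere.\<close>

lemma weak_derivative_ftc:
  fixes u :: "'a::euclidean_space \<Rightarrow> real" and G :: "'a \<Rightarrow> 'a"
  assumes W: "open W" "convex W"
    and u: "integrable lborel u" and G: "integrable lborel G"
    and weak: "\<And>\<phi> i. test_fun W \<phi> \<Longrightarrow> i \<in> Basis \<Longrightarrow>
       (LINT x|lborel. u x * frechet_derivative \<phi> (at x) i) = - (LINT x|lborel. (G x \<bullet> i) * \<phi> x)"
  shows "AE y in lborel. y \<in> W \<and> y + h \<in> W \<longrightarrow>
     u (y + h) - u y = (LINT t|lborel. indicator {0..1} t * (G (y + t *\<^sub>R h) \<bullet> h))"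
proof -
  have [measurable]: "u \<in> borel_measurable borel" "G \<in> borel_measurable borel" using u G by auto
  define T where "T = (\<lambda>y. LINT t|lborel. indicator {0..1} t * (G (y + t *\<^sub>R h) \<bullet> h))"
  define F where "F = (\<lambda>y. u (y + h) - u y - T y)"
  have nG: "(\<integral>\<^sup>+y. ennreal \<bar>G y \<bullet> h\<bar> \<partial>lborel) < \<infinity>"
    using G by (subst nn_integral_eq_integral) auto
  have pair: "integrable (lborel \<Otimes>\<^sub>M lborel) (\<lambda>(t::real, y). indicator {0..1} t * ((G (y + t *\<^sub>R h) \<bullet> h) * \<phi> y))"
    if [measurable]: "\<phi> \<in> borel_measurable borel" and \<phi>: "\<And>y. 0 \<le> \<phi> y" "\<And>y. \<phi> y \<le> 1" for \<phi>
  proof (rule integrable_lborel_pairI)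
    show "(\<lambda>(t::real, y). indicator {0..1} t * ((G (y + t *\<^sub>R h) \<bullet> h) * \<phi> y)) \<in> borel_measurable (lborel \<Otimes>\<^sub>M lborel)"
      by measurable
    have "(\<integral>\<^sup>+t. \<integral>\<^sup>+y. ennreal \<bar>indicator {0..1::real} t * ((G (y + t *\<^sub>R h) \<bullet> h) * \<phi> y)\<bar> \<partial>lborel \<partial>lborel)
       \<le> (\<integral>\<^sup>+t. \<integral>\<^sup>+y. indicator {0..1::real} t * ennreal \<bar>G (t *\<^sub>R h + y) \<bullet> h\<bar> \<partial>lborel \<partial>lborel)"
      using \<phi> by (intro nn_integral_mono)
        (auto simp: indicator_def abs_mult add.commute intro!: ennreal_leI mult_right_le_one_le)
    also have "\<dots> = (\<integral>\<^sup>+t. indicator {0..1::real} t * (\<integral>\<^sup>+y. ennreal \<bar>G y \<bullet> h\<bar> \<partial>lborel) \<partial>lborel)"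
    proof (rule nn_integral_cong)
      fix t :: real
      have "(\<integral>\<^sup>+y. ennreal \<bar>G (t *\<^sub>R h + y) \<bullet> h\<bar> \<partial>lborel) = (\<integral>\<^sup>+y. ennreal \<bar>G y \<bullet> h\<bar> \<partial>lborel)"
        by (rule nn_integral_lborel_translate[of "\<lambda>y. ennreal \<bar>G y \<bullet> h\<bar>"]) measurable
      then show "(\<integral>\<^sup>+y. indicator {0..1::real} t * ennreal \<bar>G (t *\<^sub>R h + y) \<bullet> h\<bar> \<partial>lborel)
         = indicator {0..1::real} t * (\<integral>\<^sup>+y. ennreal \<bar>G y \<bullet> h\<bar> \<partial>lborel)"
        by (simp add: nn_integral_cmult)
    qed
    also have "\<dots> = (\<integral>\<^sup>+y. ennreal \<bar>G y \<bullet> h\<bar> \<partial>lborel)"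
      by (simp add: nn_integral_multc)
    finally show "(\<integral>\<^sup>+t. \<integral>\<^sup>+y. ennreal \<bar>indicator {0..1::real} t * ((G (y + t *\<^sub>R h) \<bullet> h) * \<phi> y)\<bar> \<partial>lborel \<partial>lborel) < \<infinity>"
      using nG by (rule le_less_trans)
  qed
  \<comment> \<open>The constant weight 1 in \<open>pair\<close> yields integrability of T by
    Fubini; the bumps are inserted as weights later.\<close>
  have T: "integrable lborel T"
    using lborel_pair.integrable_snd[OF pair[of "\<lambda>_. 1"]] by (simp add: T_def)
  have F: "integrable lborel F"
    unfolding F_def by (intro Bochner_Integration.integrable_diff integrable_lborel_translate u T)
  then have [measurable]: "F \<in> borel_measurable borel" "T \<in> borel_measurable borel" using T by auto
  \<comment> \<open>The set of y with both endpoints in W is open, and a closed box inside it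
    satisfies both box conditions of the bump identity.\<close>
  have "AE y in lborel. y \<in> W \<inter> (\<lambda>y. y + h) -` W \<longrightarrow> F y = 0"
  proof (rule AE_eq_0_if_box_integrals_0[OF F])
    show "open (W \<inter> (\<lambda>y. y + h) -` W)"
      using W(1) by (intro open_Int open_vimage continuous_intros) auto
    fix a b assume ab: "cbox a b \<subseteq> W \<inter> (\<lambda>y. y + h) -` W"
    have ab': "cbox a b \<subseteq> W" "cbox (a + h) (b + h) \<subseteq> W"
    proof -
      show "cbox a b \<subseteq> W" using ab by auto
      show "cbox (a + h) (b + h) \<subseteq> W"
      proof
        fix z assume "z \<in> cbox (a + h) (b + h)"
        then have "z - h \<in> cbox a b" by (auto simp: mem_box inner_diff_left inner_add_left algebra_simps)
        then have "z - h + h \<in> W" using ab by blast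
        then show "z \<in> W" by simp
      qed
    qed
    have zero: "(LINT y|lborel. bump k a b y * F y) = 0" if k: "0 < k" for k
    proof -
      let ?\<phi> = "bump k a b"
      have ub: "integrable lborel (\<lambda>y. f y * bump k c d y)" if "integrable lborel f" for f c d
      proof (rule Bochner_Integration.integrable_bound[OF that])
        show "AE y in lborel. norm (f y * bump k c d y) \<le> norm (f y)"
          by (auto simp: abs_mult bump_bounds intro!: AE_I2 mult_right_le_one_le)
        show "(\<lambda>y. f y * bump k c d y) \<in> borel_measurable lborel"
          using borel_measurable_integrable[OF that] by measurable
      qed
      have "(LINT y|lborel. u y * (?\<phi> (y - h) - ?\<phi> y)) = (LINT y|lborel. u y * ?\<phi> (y - h)) - (LINT y|lborel. u y * ?\<phi> y)"
        unfolding bump_translate right_diff_distrib by (rule Bochner_Integration.integral_diff[OF ub[OF u] ub[OF u]])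
      also have "(LINT y|lborel. u y * ?\<phi> (y - h)) = (LINT y|lborel. u (y + h) * ?\<phi> y)"
        using integral_lborel_translate[of "\<lambda>y. u y * ?\<phi> (y - h)" h] by simp
      finally have L: "(LINT y|lborel. u y * (?\<phi> (y - h) - ?\<phi> y)) = (LINT y|lborel. u (y + h) * ?\<phi> y) - (LINT y|lborel. u y * ?\<phi> y)" .
      have "(LINT t|lborel. indicator {0..1} t * (LINT y|lborel. (G y \<bullet> h) * ?\<phi> (y - t *\<^sub>R h)))
         = (LINT t|lborel. LINT y|lborel. indicator {0..1} t * ((G (y + t *\<^sub>R h) \<bullet> h) * ?\<phi> y))"
      proof (rule Bochner_Integration.integral_cong[OF refl])
        fix t :: real
        show "indicator {0..1} t * (LINT y|lborel. (G y \<bullet> h) * ?\<phi> (y - t *\<^sub>R h))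
           = (LINT y|lborel. indicator {0..1} t * ((G (y + t *\<^sub>R h) \<bullet> h) * ?\<phi> y))"
          using integral_lborel_translate[of "\<lambda>y. (G y \<bullet> h) * ?\<phi> (y - t *\<^sub>R h)" "t *\<^sub>R h"] by simp
      qed
      also have "\<dots> = (LINT y|lborel. LINT t|lborel. indicator {0..1} t * ((G (y + t *\<^sub>R h) \<bullet> h) * ?\<phi> y))"
        by (rule lborel_pair.Fubini_integral[symmetric], rule pair) (auto simp: bump_bounds)
      also have "\<dots> = (LINT y|lborel. T y * ?\<phi> y)"
        unfolding T_def by (simp add: mult.assoc flip: integral_mult_left_zero)
      finally have R: "(LINT t|lborel. indicator {0..1} t * (LINT y|lborel. (G y \<bullet> h) * ?\<phi> (y - t *\<^sub>R h))) = (LINT y|lborel. T y * ?\<phi> y)" .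
      have "(LINT y|lborel. ?\<phi> y * F y) = (LINT y|lborel. u (y + h) * ?\<phi> y - u y * ?\<phi> y - T y * ?\<phi> y)"
        by (simp add: F_def algebra_simps)
      also have "\<dots> = (LINT y|lborel. u (y + h) * ?\<phi> y) - (LINT y|lborel. u y * ?\<phi> y) - (LINT y|lborel. T y * ?\<phi> y)"
        by (simp add: ub u T integrable_lborel_translate)
      also have "\<dots> = 0"
        using weak_derivative_ftc_bump[OF W u G weak k ab'] L R by simp
      finally show ?thesis .
    qed
    have "(\<lambda>n. LINT y|lborel. bump (real (Suc n)) a b y * F y) \<longlonglongrightarrow> (LINT y|lborel. indicator (box a b) y * F y)"
    proof (rule integral_dominated_convergence[where w="\<lambda>y. \<bar>F y\<bar>"])
      show "AE y in lborel. (\<lambda>n. bump (real (Suc n)) a b y * F y) \<longlonglongrightarrow> indicator (box a b) y * F y"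
        by (intro AE_I2 tendsto_mult bump_tendsto_indicator tendsto_const)
      show "AE y in lborel. norm (bump (real (Suc n)) a b y * F y) \<le> \<bar>F y\<bar>" for n
        by (auto simp: abs_mult bump_bounds intro!: AE_I2 mult_left_le_one_le)
      show "(\<lambda>y. bump (real (Suc n)) a b y * F y) \<in> borel_measurable lborel" for n
        by measurable
    qed (use F in auto)
    then show "(LINT y|lborel. indicator (box a b) y * F y) = 0"
      using zero by (simp add: LIMSEQ_const_iff)
  qed
  then show ?thesis by eventually_elim (auto simp: F_def T_def)
qed

section \<open>Riesz potential bound on convex sets\<close>

text \<open>With h = w / t the volume element contributes t^-n and |h| contributes 1/t. Since x + w
  / t lies in W, |w| \<le> t D, so t runs over t \<ge> |w| / D, and the integral of t^(-n-1) there
  is (|w| / D)^-n / n. Together with |w| this is the Riesz kernel |w|^(1-n) times D^n / n.\<close>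

lemma nn_integral_segment_kernel:
  fixes G :: "'a::euclidean_space \<Rightarrow> 'a"
  assumes [measurable]: "G \<in> borel_measurable borel" "W \<in> sets borel"
    and D: "0 < D" "\<And>x z. x \<in> W \<Longrightarrow> z \<in> W \<Longrightarrow> norm (x - z) \<le> D" and x: "x \<in> W"
  shows "(\<integral>\<^sup>+t. \<integral>\<^sup>+h. indicator {0<..1::real} t * (indicator W (x + h) * ennreal (norm (G (x + t *\<^sub>R h)) * norm h)) \<partial>lborel \<partial>lborel)
     \<le> ennreal (D ^ DIM('a) / real DIM('a)) * (\<integral>\<^sup>+w. ennreal (norm (x - w) powr (1 - real DIM('a)) * norm (G w)) \<partial>lborel)"
proof -
  let ?n = "real DIM('a)"
  \<comment> \<open>The condition |w| \<le> t D is kept as a function of both variables, so that the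
    joint measurability required by Fubini is available.\<close>
  define \<rho> where "\<rho> = (\<lambda>(w::'a) t. if norm w \<le> t * D then 1 else 0 :: ennreal)"
  have [measurable]: "(\<lambda>z. \<rho> (f z) (g z)) \<in> borel_measurable M"
    if [measurable]: "f \<in> borel_measurable M" "g \<in> borel_measurable M" for f g and M :: "'z measure"
    unfolding \<rho>_def by measurable
  have 1: "(\<integral>\<^sup>+h. indicator {0<..1::real} t * (indicator W (x + h) * ennreal (norm (G (x + t *\<^sub>R h)) * norm h)) \<partial>lborel)
      \<le> (\<integral>\<^sup>+w. ennreal (norm w * norm (G (x + w))) * (ennreal (t powr (- ?n - 1)) * indicator {0<..} t * \<rho> w t) \<partial>lborel)" for t
  proof (cases "0 < t \<and> t \<le> 1")
    case True
    then have t: "0 < t" "t \<le> 1" by auto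
    let ?\<Phi> = "\<lambda>h. indicator W (x + h) * ennreal (norm (G (x + t *\<^sub>R h)) * norm h)"
    have "(\<integral>\<^sup>+h. ?\<Phi> h \<partial>lborel) = ennreal (\<bar>1/t\<bar> ^ DIM('a)) * (\<integral>\<^sup>+w. ?\<Phi> (0 + (1/t) *\<^sub>R w) \<partial>lborel)"
      using t by (intro nn_integral_lborel_affine) auto
    also have "\<dots> = (\<integral>\<^sup>+w. ennreal (\<bar>1/t\<bar> ^ DIM('a)) * ?\<Phi> (0 + (1/t) *\<^sub>R w) \<partial>lborel)"
      by (intro nn_integral_cmult[symmetric]) measurable
    also have "\<dots> \<le> (\<integral>\<^sup>+w. ennreal (norm w * norm (G (x + w))) * (ennreal (t powr (- ?n - 1)) * indicator {0<..} t * \<rho> w t) \<partial>lborel)"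
    proof (rule nn_integral_mono)
      fix w :: 'a
      \<comment> \<open>The power comes from the Jacobian and the last factor from |h| = |w| /
        t.\<close>
      have p: "(1/t) ^ DIM('a) * (1/t) = t powr (- ?n - 1)"
        using t by (simp add: powr_diff powr_minus powr_realpow field_simps power_divide)
      show "ennreal (\<bar>1/t\<bar> ^ DIM('a)) * ?\<Phi> (0 + (1/t) *\<^sub>R w)
         \<le> ennreal (norm w * norm (G (x + w))) * (ennreal (t powr (- ?n - 1)) * indicator {0<..} t * \<rho> w t)"
      proof (cases "x + (1/t) *\<^sub>R w \<in> W")
        case True
        have "norm (x - (x + (1/t) *\<^sub>R w)) \<le> D" by (rule D(2)[OF x True])
        then have "norm w \<le> t * D" using t by (simp add: field_simps)
        moreover have "ennreal (\<bar>1/t\<bar> ^ DIM('a)) * ennreal (norm (G (x + w)) * (norm w / t))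
           = ennreal (norm w * norm (G (x + w))) * ennreal (t powr (- ?n - 1))"
          using t unfolding p[symmetric] by (simp add: mult_ac flip: ennreal_mult)
        ultimately show ?thesis using True t
          by (simp add: \<rho>_def)
      qed simp
    qed
    finally show ?thesis using t by simp
  qed auto
  have 2: "(\<integral>\<^sup>+t. ennreal (norm w * norm (G (x + w))) * (ennreal (t powr (- ?n - 1)) * indicator {0<..} t * \<rho> w t) \<partial>lborel)
      \<le> ennreal (D ^ DIM('a) / ?n) * ennreal (norm w powr (1 - ?n) * norm (G (x + w)))" for w :: 'a
  proof (cases "w = 0")
    case False
    define r where "r = norm w / D"
    have r: "0 < r" using False D by (simp add: r_def)
    have "(\<integral>\<^sup>+t. ennreal (t powr (- ?n - 1)) * indicator {0<..} t * \<rho> w t \<partial>lborel)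
       \<le> (\<integral>\<^sup>+t. ennreal (1 / ?n) * (ennreal (?n * t powr (- ?n - 1)) * indicator {r..} t) \<partial>lborel)"
      using D by (intro nn_integral_mono) (auto simp: \<rho>_def r_def indicator_def field_simps simp flip: ennreal_mult)
    also have "\<dots> = ennreal (1 / ?n) * ennreal (r powr (- ?n))"
      using r by (subst nn_integral_cmult) (auto simp: nn_integral_powr_atLeast)
    finally have "ennreal (norm w * norm (G (x + w))) * (\<integral>\<^sup>+t. ennreal (t powr (- ?n - 1)) * indicator {0<..} t * \<rho> w t \<partial>lborel)
       \<le> ennreal (norm w * norm (G (x + w))) * (ennreal (1 / ?n) * ennreal (r powr (- ?n)))"
      by (intro mult_left_mono) auto
    also have "\<dots> = ennreal ((norm w * r powr (- ?n)) / ?n * norm (G (x + w)))"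
      by (simp flip: ennreal_mult add: mult_ac)
    also have "norm w * r powr (- ?n) = D ^ DIM('a) * norm w powr (1 - ?n)"
      using False D by (simp add: r_def powr_divide powr_minus powr_diff powr_realpow field_simps)
    also have "ennreal ((D ^ DIM('a) * norm w powr (1 - ?n)) / ?n * norm (G (x + w)))
       = ennreal (D ^ DIM('a) / ?n) * ennreal (norm w powr (1 - ?n) * norm (G (x + w)))"
      using D by (simp flip: ennreal_mult)
    finally show ?thesis by (subst nn_integral_cmult) auto
  qed simp
  have "(\<integral>\<^sup>+t. \<integral>\<^sup>+h. indicator {0<..1::real} t * (indicator W (x + h) * ennreal (norm (G (x + t *\<^sub>R h)) * norm h)) \<partial>lborel \<partial>lborel)
     \<le> (\<integral>\<^sup>+t. \<integral>\<^sup>+w. ennreal (norm w * norm (G (x + w))) * (ennreal (t powr (- ?n - 1)) * indicator {0<..} t * \<rho> w t) \<partial>lborel \<partial>lborel)"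
    by (rule nn_integral_mono) (rule 1)
  also have "\<dots> = (\<integral>\<^sup>+w. \<integral>\<^sup>+t. ennreal (norm w * norm (G (x + w))) * (ennreal (t powr (- ?n - 1)) * indicator {0<..} t * \<rho> w t) \<partial>lborel \<partial>lborel)"
    by (rule lborel_pair.Fubini'[symmetric]) measurable
  also have "\<dots> \<le> (\<integral>\<^sup>+w. ennreal (D ^ DIM('a) / ?n) * ennreal (norm w powr (1 - ?n) * norm (G (x + w))) \<partial>lborel)"
    by (rule nn_integral_mono) (rule 2)
  also have "\<dots> = ennreal (D ^ DIM('a) / ?n) * (\<integral>\<^sup>+w. ennreal (norm w powr (1 - ?n) * norm (G (x + w))) \<partial>lborel)"
    by (rule nn_integral_cmult) measurable
  also have "(\<integral>\<^sup>+w. ennreal (norm w powr (1 - ?n) * norm (G (x + w))) \<partial>lborel)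
     = (\<integral>\<^sup>+w. ennreal (norm (x - w) powr (1 - ?n) * norm (G w)) \<partial>lborel)"
    using nn_integral_lborel_translate[of "\<lambda>w. ennreal (norm (x - w) powr (1 - ?n) * norm (G w))" x] by simp
  finally show ?thesis .
qed

text \<open>The weight g replaces a pointwise bound in x: the segment identity for a given h fails
  on a null set depending on h, and integrating over x for fixed h disposes of these null
  sets.\<close>

lemma convex_riesz_potential_bound:
  fixes u :: "'a::euclidean_space \<Rightarrow> real" and G :: "'a \<Rightarrow> 'a" and g :: "'a \<Rightarrow> ennreal"
  assumes W: "open W" "convex W"
    and u: "integrable lborel u" and G: "integrable lborel G"
    and weak: "\<And>\<phi> i. test_fun W \<phi> \<Longrightarrow> i \<in> Basis \<Longrightarrow>
       (LINT x|lborel. u x * frechet_derivative \<phi> (at x) i) = - (LINT x|lborel. (G x \<bullet> i) * \<phi> x)"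
    and D: "0 < D" "\<And>x z. x \<in> W \<Longrightarrow> z \<in> W \<Longrightarrow> norm (x - z) \<le> D"
    and [measurable]: "g \<in> borel_measurable borel"
  shows "(\<integral>\<^sup>+x. indicator W x * g x * (\<integral>\<^sup>+z. indicator W z * ennreal \<bar>u x - u z\<bar> \<partial>lborel) \<partial>lborel)
     \<le> ennreal (D ^ DIM('a) / real DIM('a)) *
        (\<integral>\<^sup>+x. g x * (\<integral>\<^sup>+w. ennreal (norm (x - w) powr (1 - real DIM('a)) * norm (G w)) \<partial>lborel) \<partial>lborel)"
proof -
  have [measurable]: "u \<in> borel_measurable borel" "G \<in> borel_measurable borel" "W \<in> sets borel"
    using u G W by auto
  let ?n = "real DIM('a)"
  let ?S = "\<lambda>x h t. indicator {0<..1::real} t * (indicator W (x + h) * ennreal (norm (G (x + t *\<^sub>R h)) * norm h))"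
  have seg: "AE x in lborel. indicator W x * g x * (indicator W (x + h) * ennreal \<bar>u x - u (x + h)\<bar>)
       \<le> indicator W x * g x * (\<integral>\<^sup>+t. ?S x h t \<partial>lborel)" for h
  proof -
    have "AE x in lborel. x \<in> W \<and> x + h \<in> W \<longrightarrow>
       u (x + h) - u x = (LINT t|lborel. indicator {0..1} t * (G (x + t *\<^sub>R h) \<bullet> h))"
      using weak by (rule weak_derivative_ftc[OF W u G])
    then show ?thesis
    proof eventually_elim
      case (elim x)
      show ?case
      proof (cases "x \<in> W \<and> x + h \<in> W")
        case True
        let ?f = "\<lambda>t. indicator {0..1} t * (G (x + t *\<^sub>R h) \<bullet> h)"
        have "ennreal \<bar>u x - u (x + h)\<bar> = ennreal (norm (LINT t|lborel. ?f t))"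
          using elim True by (simp add: abs_minus_commute)
        also have "\<dots> \<le> (\<integral>\<^sup>+t. ennreal (norm (?f t)) \<partial>lborel)"
          \<comment> \<open>Without integrability along the segment the Bochner integral is 0 by
            default, so the bound still holds.\<close>
          using integral_norm_bound_ennreal[of lborel ?f]
          by (cases "integrable lborel ?f") (auto simp: not_integrable_integral_eq)
        also have "\<dots> \<le> (\<integral>\<^sup>+t. ?S x h t \<partial>lborel)"
        proof (rule nn_integral_mono_AE)
          \<comment> \<open>\<open>?S\<close> uses the half-open interval because the substitution w
            = t h requires t > 0; the endpoint is a null set.\<close>
          have "AE t in lborel. t \<noteq> (0::real)" by (rule AE_lborel_singleton)
          then show "AE t in lborel. ennreal (norm (?f t)) \<le> ?S x h t"
            by eventually_elim (use True in \<open>auto simp: indicator_def intro!: ennreal_leI Cauchy_Schwarz_ineq2\<close>)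
        qed
        finally show ?thesis using True by (intro mult_left_mono) auto
      qed auto
    qed
  qed
  have "(\<integral>\<^sup>+x. indicator W x * g x * (\<integral>\<^sup>+z. indicator W z * ennreal \<bar>u x - u z\<bar> \<partial>lborel) \<partial>lborel)
     = (\<integral>\<^sup>+x. \<integral>\<^sup>+h. indicator W x * g x * (indicator W (x + h) * ennreal \<bar>u x - u (x + h)\<bar>) \<partial>lborel \<partial>lborel)"
  proof (rule nn_integral_cong)
    fix x
    have "(\<integral>\<^sup>+h. indicator W (x + h) * ennreal \<bar>u x - u (x + h)\<bar> \<partial>lborel) = (\<integral>\<^sup>+z. indicator W z * ennreal \<bar>u x - u z\<bar> \<partial>lborel)"
      by (rule nn_integral_lborel_translate[of "\<lambda>z. indicator W z * ennreal \<bar>u x - u z\<bar>"]) measurable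
    then show "indicator W x * g x * (\<integral>\<^sup>+z. indicator W z * ennreal \<bar>u x - u z\<bar> \<partial>lborel)
       = (\<integral>\<^sup>+h. indicator W x * g x * (indicator W (x + h) * ennreal \<bar>u x - u (x + h)\<bar>) \<partial>lborel)"
      by (subst nn_integral_cmult) auto
  qed
  \<comment> \<open>\<open>seg\<close> holds for almost every x once h is fixed, so the x-integral
    has to become the inner one before it is used.\<close>
  also have "\<dots> = (\<integral>\<^sup>+h. \<integral>\<^sup>+x. indicator W x * g x * (indicator W (x + h) * ennreal \<bar>u x - u (x + h)\<bar>) \<partial>lborel \<partial>lborel)"
    by (rule lborel_pair.Fubini'[symmetric]) measurable
  also have "\<dots> \<le> (\<integral>\<^sup>+h. \<integral>\<^sup>+x. indicator W x * g x * (\<integral>\<^sup>+t. ?S x h t \<partial>lborel) \<partial>lborel \<partial>lborel)"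
    by (intro nn_integral_mono nn_integral_mono_AE seg)
  also have "\<dots> = (\<integral>\<^sup>+x. \<integral>\<^sup>+h. indicator W x * g x * (\<integral>\<^sup>+t. ?S x h t \<partial>lborel) \<partial>lborel \<partial>lborel)"
    by (rule lborel_pair.Fubini') measurable
  also have "\<dots> = (\<integral>\<^sup>+x. indicator W x * g x * (\<integral>\<^sup>+h. \<integral>\<^sup>+t. ?S x h t \<partial>lborel \<partial>lborel) \<partial>lborel)"
    by (intro nn_integral_cong nn_integral_cmult) measurable
  also have "\<dots> = (\<integral>\<^sup>+x. indicator W x * g x * (\<integral>\<^sup>+t. \<integral>\<^sup>+h. ?S x h t \<partial>lborel \<partial>lborel) \<partial>lborel)"
    by (intro nn_integral_cong arg_cong2[where f="(*)"] refl lborel_pair.Fubini'[symmetric]) measurable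
  also have "\<dots> \<le> (\<integral>\<^sup>+x. g x * (ennreal (D ^ DIM('a) / ?n) * (\<integral>\<^sup>+w. ennreal (norm (x - w) powr (1 - ?n) * norm (G w)) \<partial>lborel)) \<partial>lborel)"
  proof (rule nn_integral_mono)
    fix x
    show "indicator W x * g x * (\<integral>\<^sup>+t. \<integral>\<^sup>+h. ?S x h t \<partial>lborel \<partial>lborel)
       \<le> g x * (ennreal (D ^ DIM('a) / ?n) * (\<integral>\<^sup>+w. ennreal (norm (x - w) powr (1 - ?n) * norm (G w)) \<partial>lborel))"
      using nn_integral_segment_kernel[of G W D x] D
      by (cases "x \<in> W") (auto intro!: mult_left_mono)
  qed
  also have "\<dots> = ennreal (D ^ DIM('a) / ?n) * (\<integral>\<^sup>+x. g x * (\<integral>\<^sup>+w. ennreal (norm (x - w) powr (1 - ?n) * norm (G w)) \<partial>lborel) \<partial>lborel)"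
    by (subst nn_integral_cmult[symmetric]) (auto simp: mult_ac)
  finally show ?thesis .
qed

text \<open>Since c is the mean of u over W, m (u x - c) is the integral of u x - u z over z in W;
  its modulus is at most the quantity bounded in \<open>convex_riesz_potential_bound\<close>.
  Division by m completes the constant.\<close>

lemma mean_deviation_riesz_bound:
  fixes u :: "'a::euclidean_space \<Rightarrow> real" and G :: "'a \<Rightarrow> 'a" and g :: "'a \<Rightarrow> ennreal"
  assumes W: "open W" "convex W" "bounded W" "W \<noteq> {}"
    and u: "integrable lborel u" and G: "integrable lborel G"
    and weak: "\<And>\<phi> i. test_fun W \<phi> \<Longrightarrow> i \<in> Basis \<Longrightarrow>
       (LINT x|lborel. u x * frechet_derivative \<phi> (at x) i) = - (LINT x|lborel. (G x \<bullet> i) * \<phi> x)"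
    and D: "0 < D" "\<And>x z. x \<in> W \<Longrightarrow> z \<in> W \<Longrightarrow> norm (x - z) \<le> D"
    and [measurable]: "g \<in> borel_measurable borel"
  defines "m \<equiv> measure lborel W"
  defines "c \<equiv> (LINT y|lborel. indicator W y * u y) / m"
  shows "(\<integral>\<^sup>+x. indicator W x * g x * ennreal \<bar>u x - c\<bar> \<partial>lborel)
     \<le> ennreal (D ^ DIM('a) / (real DIM('a) * m)) *
        (\<integral>\<^sup>+x. g x * (\<integral>\<^sup>+w. ennreal (norm (x - w) powr (1 - real DIM('a)) * norm (G w)) \<partial>lborel) \<partial>lborel)"
proof -
  have [measurable]: "u \<in> borel_measurable borel" "W \<in> sets borel"
    using u W by auto
  have fin: "emeasure lborel W < \<infinity>" using emeasure_bounded_finite[OF W(3)] .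
  have emW: "emeasure lborel W = ennreal m" using fin by (simp add: m_def emeasure_eq_ennreal_measure less_top)
  have m: "0 < m"
  proof -
    have "emeasure lborel W \<noteq> 0" using W(1,4) open_not_negligible[of W]
      by (auto simp: negligible_iff_emeasure0)
    then show ?thesis using emW by (simp add: m_def zero_less_measure_iff)
  qed
  have i1: "integrable lborel (indicator W :: 'a \<Rightarrow> real)" using fin by (simp add: integrable_indicator_iff)
  have iu: "integrable lborel (\<lambda>y. indicator W y * u y)"
    by (rule Bochner_Integration.integrable_bound[OF u]) (auto simp: indicator_def intro!: AE_I2)
  have "ennreal m * ennreal \<bar>u x - c\<bar> \<le> (\<integral>\<^sup>+z. indicator W z * ennreal \<bar>u x - u z\<bar> \<partial>lborel)" for x
  proof -
    have eq: "m * (u x - c) = (LINT z|lborel. u x * indicator W z - indicator W z * u z)"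
      using i1 iu m fin by (simp add: c_def m_def algebra_simps)
    have "ennreal m * ennreal \<bar>u x - c\<bar> = ennreal (norm (LINT z|lborel. u x * indicator W z - indicator W z * u z))"
      unfolding eq[symmetric] using m by (simp add: abs_mult flip: ennreal_mult)
    also have "\<dots> \<le> (\<integral>\<^sup>+z. ennreal (norm (u x * indicator W z - indicator W z * u z)) \<partial>lborel)"
      using i1 iu by (intro integral_norm_bound_ennreal) auto
    also have "\<dots> = (\<integral>\<^sup>+z. indicator W z * ennreal \<bar>u x - u z\<bar> \<partial>lborel)"
      by (intro nn_integral_cong) (auto simp: indicator_def)
    finally show ?thesis .
  qed
  then have "(\<integral>\<^sup>+x. indicator W x * g x * (ennreal m * ennreal \<bar>u x - c\<bar>) \<partial>lborel)
     \<le> (\<integral>\<^sup>+x. indicator W x * g x * (\<integral>\<^sup>+z. indicator W z * ennreal \<bar>u x - u z\<bar> \<partial>lborel) \<partial>lborel)"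
    by (intro nn_integral_mono mult_left_mono) auto
  also have "\<dots> \<le> ennreal (D ^ DIM('a) / real DIM('a)) *
        (\<integral>\<^sup>+x. g x * (\<integral>\<^sup>+w. ennreal (norm (x - w) powr (1 - real DIM('a)) * norm (G w)) \<partial>lborel) \<partial>lborel)"
    (is "_ \<le> _ * ?R")
    using weak D by (intro convex_riesz_potential_bound[OF W(1,2) u G]) auto
  finally have *: "(\<integral>\<^sup>+x. indicator W x * g x * (ennreal m * ennreal \<bar>u x - c\<bar>) \<partial>lborel) \<le> ennreal (D ^ DIM('a) / real DIM('a)) * ?R" .
  have "(\<integral>\<^sup>+x. indicator W x * g x * ennreal \<bar>u x - c\<bar> \<partial>lborel)
     = (\<integral>\<^sup>+x. ennreal (1/m) * (indicator W x * g x * (ennreal m * ennreal \<bar>u x - c\<bar>)) \<partial>lborel)"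
  proof (rule nn_integral_cong)
    fix x
    have "ennreal (1/m) * (indicator W x * g x * (ennreal m * ennreal \<bar>u x - c\<bar>))
       = (ennreal (1/m) * ennreal m) * (indicator W x * g x * ennreal \<bar>u x - c\<bar>)" by (simp only: mult_ac)
    also have "ennreal (1/m) * ennreal m = 1" using m by (simp flip: ennreal_mult)
    finally show "indicator W x * g x * ennreal \<bar>u x - c\<bar> = ennreal (1/m) * (indicator W x * g x * (ennreal m * ennreal \<bar>u x - c\<bar>))" by simp
  qed
  also have "\<dots> = ennreal (1/m) * (\<integral>\<^sup>+x. indicator W x * g x * (ennreal m * ennreal \<bar>u x - c\<bar>) \<partial>lborel)"
    by (rule nn_integral_cmult) measurable
  also have "\<dots> \<le> ennreal (1/m) * (ennreal (D ^ DIM('a) / real DIM('a)) * ?R)"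
    by (rule mult_left_mono[OF *]) simp
  also have "\<dots> = ennreal (D ^ DIM('a) / (real DIM('a) * m)) * ?R"
    using m D by (simp add: mult_ac flip: mult.assoc ennreal_mult)
  finally show ?thesis .
qed

section \<open>Interpolation\<close>

text \<open>Hoelder's inequality with exponents 1/\<theta> and 1/(1-\<theta>): Young's inequality is
  applied to a and b divided by their integrals, and the weights \<theta> and 1-\<theta> sum to 1.
  If one integral is 0, the product vanishes almost everywhere.\<close>

lemma integral_powr_interpolation:
  fixes a b :: "'a \<Rightarrow> real"
  assumes a: "integrable M a" "\<And>x. 0 \<le> a x" and b: "integrable M b" "\<And>x. 0 \<le> b x"
    and th: "0 < \<theta>" "\<theta> < 1"
  shows "integrable M (\<lambda>x. a x powr \<theta> * b x powr (1 - \<theta>))"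
    and "(LINT x|M. a x powr \<theta> * b x powr (1 - \<theta>)) \<le> (LINT x|M. a x) powr \<theta> * (LINT x|M. b x) powr (1 - \<theta>)"
proof -
  have [measurable]: "a \<in> borel_measurable M" "b \<in> borel_measurable M" using a b by auto
  have young: "s powr \<theta> * t powr (1 - \<theta>) \<le> \<theta> * s + (1 - \<theta>) * t" if "0 \<le> s" "0 \<le> t" for s t :: real
    using Youngs_inequality_0[of \<theta> "1 - \<theta>" s t] that th by (cases "s = 0 \<or> t = 0") auto
  show int: "integrable M (\<lambda>x. a x powr \<theta> * b x powr (1 - \<theta>))"
  proof (rule Bochner_Integration.integrable_bound[of _ "\<lambda>x. \<theta> * a x + (1 - \<theta>) * b x"])
    show "AE x in M. norm (a x powr \<theta> * b x powr (1 - \<theta>)) \<le> norm (\<theta> * a x + (1 - \<theta>) * b x)"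
      using young a(2) b(2) by (intro AE_I2) (auto intro: order_trans[OF _ abs_ge_self])
  qed (use a b in auto)
  let ?A = "LINT x|M. a x" and ?B = "LINT x|M. b x"
  have nn: "0 \<le> ?A" "0 \<le> ?B" using a b by auto
  show "(LINT x|M. a x powr \<theta> * b x powr (1 - \<theta>)) \<le> ?A powr \<theta> * ?B powr (1 - \<theta>)"
  proof (cases "?A = 0 \<or> ?B = 0")
    case True
    then have "AE x in M. a x = 0 \<or> b x = 0"
    proof
      assume "?A = 0"
      then have "AE x in M. a x = 0" using a by (simp add: integral_nonneg_eq_0_iff_AE)
      then show ?thesis by eventually_elim simp
    next
      assume "?B = 0"
      then have "AE x in M. b x = 0" using b by (simp add: integral_nonneg_eq_0_iff_AE)
      then show ?thesis by eventually_elim simp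
    qed
    then have "AE x in M. a x powr \<theta> * b x powr (1 - \<theta>) = 0" by eventually_elim auto
    then have "(LINT x|M. a x powr \<theta> * b x powr (1 - \<theta>)) = 0"
      by (rule integral_eq_zero_AE)
    then show ?thesis by simp
  next
    case False
    then have pos: "0 < ?A" "0 < ?B" using nn by auto
    have "(LINT x|M. a x powr \<theta> * b x powr (1 - \<theta>))
       \<le> (LINT x|M. (?A powr \<theta> * ?B powr (1 - \<theta>)) * (\<theta> / ?A * a x + (1 - \<theta>) / ?B * b x))"
    proof (rule integral_mono[OF int])
      fix x
      have "a x powr \<theta> * b x powr (1 - \<theta>) = (?A powr \<theta> * ?B powr (1 - \<theta>)) * ((a x / ?A) powr \<theta> * (b x / ?B) powr (1 - \<theta>))"
        using pos a(2) b(2) by (simp add: powr_divide)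
      also have "\<dots> \<le> (?A powr \<theta> * ?B powr (1 - \<theta>)) * (\<theta> * (a x / ?A) + (1 - \<theta>) * (b x / ?B))"
        using pos a(2) b(2) by (intro mult_left_mono young) auto
      finally show "a x powr \<theta> * b x powr (1 - \<theta>) \<le> (?A powr \<theta> * ?B powr (1 - \<theta>)) * (\<theta> / ?A * a x + (1 - \<theta>) / ?B * b x)"
        by simp
    qed (use a b in auto)
    also have "\<dots> = (?A powr \<theta> * ?B powr (1 - \<theta>)) * (\<theta> / ?A * ?A + (1 - \<theta>) / ?B * ?B)"
      using a b by simp
    also have "\<dots> = ?A powr \<theta> * ?B powr (1 - \<theta>)" using pos by simp
    finally show ?thesis .
  qed
qed

text \<open>The right-hand side is free of the truncation level k, so k can tend to infinity
  afterwards. The potential bound \<open>riesz\<close> concerns the untruncated v; truncation enters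
  only through the weight and the integral X, which it makes finite.\<close>

lemma truncated_deviation_bound:
  fixes v :: "'a::euclidean_space \<Rightarrow> real" and G :: "'a \<Rightarrow> 'a"
  defines "n \<equiv> real DIM('a)"
  assumes n: "3 \<le> n" and W: "W \<in> sets borel" "bounded W"
    and [measurable]: "v \<in> borel_measurable borel" "G \<in> borel_measurable borel"
    and B: "integrable lborel (\<lambda>x. indicator W x * (v x)\<^sup>2)"
    and A: "integrable lborel (\<lambda>x. (norm (G x))\<^sup>2)"
    and riesz: "\<And>g. g \<in> borel_measurable borel \<Longrightarrow>
      (\<integral>\<^sup>+x. indicator W x * g x * ennreal \<bar>v x\<bar> \<partial>lborel)
     \<le> ennreal E * (\<integral>\<^sup>+x. g x * (\<integral>\<^sup>+w. ennreal (norm (x - w) powr (1 - n) * norm (G w)) \<partial>lborel) \<partial>lborel)"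
    and E: "0 \<le> E"
  defines "C \<equiv> E * C_HLS TYPE('a) (n - 1) 2"
  shows "(\<integral>\<^sup>+x. indicator W x * ennreal (min \<bar>v x\<bar> (real k) powr (2 + 4 / n)) \<partial>lborel)
     \<le> ennreal (if 0 < C then C\<^sup>2 * (LINT x|lborel. (norm (G x))\<^sup>2) * (LINT x|lborel. indicator W x * (v x)\<^sup>2) powr (2 / n) else 0)"
proof -
  have [measurable]: "W \<in> sets borel" by fact
  define w where "w = (\<lambda>x. min \<bar>v x\<bar> (real k))"
  have [measurable]: "w \<in> borel_measurable borel" unfolding w_def by measurable
  have w0: "0 \<le> w x" and wk: "w x \<le> real k" and wv: "w x \<le> \<bar>v x\<bar>" for x by (auto simp: w_def)
  \<comment> \<open>The exponent dual to p = 2 for the kernel of order n - 1: 1/2 + (n-1)/n + 1/r =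
    2.\<close>
  define r where "r = 2 * n / (n + 2)"
  have r: "1 < r" using n by (simp add: r_def field_simps)
  have r1: "1 / r = (n + 2) / (2 * n)" by (simp add: r_def)
  \<comment> \<open>Chosen so that (1 + 4/n) r = 2 \<theta> + (2 + 4/n)(1 - \<theta>), which writes
    |h|^r as an interpolation between a and b. After taking the power 1/r, the exponents become 1/n
    and 1/2.\<close>
  define \<theta> where "\<theta> = 2 / (n + 2)"
  have \<theta>: "0 < \<theta>" "\<theta> < 1" "1 - \<theta> = n / (n + 2)" using n by (auto simp: \<theta>_def field_simps)
  have ibd: "integrable lborel (\<lambda>x. indicator W x * w x powr s)" if "0 < s" for s
  proof (rule Bochner_Integration.integrable_bound[of _ "\<lambda>x. real k powr s * indicator W x"])
    show "integrable lborel (\<lambda>x. real k powr s * indicat_real W x)"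
      using emeasure_bounded_finite[OF W(2)] by (simp add: integrable_indicator_iff)
    show "AE x in lborel. norm (indicator W x * w x powr s) \<le> norm (real k powr s * indicator W x)"
      using w0 wk that by (intro AE_I2) (auto simp: indicator_def intro!: powr_mono2)
  qed simp
  define a where "a = (\<lambda>x. indicator W x * (w x)\<^sup>2)"
  define b where "b = (\<lambda>x. indicator W x * w x powr (2 + 4 / n))"
  define X where "X = (LINT x|lborel. b x)"
  have ia: "integrable lborel a"
    using ibd[of 2] w0 by (simp add: a_def powr_numeral)
  have ib: "integrable lborel b"
    unfolding b_def using n by (intro ibd) (simp add: add_pos_pos)
  have ab0: "0 \<le> a x" "0 \<le> b x" for x by (auto simp: a_def b_def)
  have X0: "0 \<le> X" unfolding X_def using ab0 by simp
  define f where "f = (\<lambda>x. norm (G x))"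
  define h where "h = (\<lambda>x. indicator W x * w x powr (1 + 4 / n))"
  have [measurable]: "f \<in> borel_measurable borel" "h \<in> borel_measurable borel" unfolding f_def h_def by measurable
  have hr: "\<bar>h x\<bar> powr r = a x powr \<theta> * b x powr (1 - \<theta>)" for x
  proof (cases "x \<in> W")
    case True
    have e: "(1 + 4 / n) * r = 2 * \<theta> + (2 + 4 / n) * (1 - \<theta>)"
      unfolding \<theta>(3) using n by (simp add: r_def \<theta>_def divide_simps) (simp add: algebra_simps)
    have "(w x)\<^sup>2 = w x powr 2" using w0[of x] by simp
    then have "(w x)\<^sup>2 powr \<theta> = w x powr (2 * \<theta>)" by (simp only: powr_powr)
    moreover have "w x powr ((1 + 4 / n) * r) = w x powr (2 * \<theta>) * w x powr ((2 + 4 / n) * (1 - \<theta>))"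
      unfolding e by (rule powr_add)
    ultimately show ?thesis using True by (simp add: h_def a_def b_def powr_powr)
  qed (use \<theta> in \<open>auto simp: h_def a_def b_def\<close>)
  have fL: "in_Lp 2 f" using A by (simp add: in_Lp_def f_def)
  have hL: "in_Lp r h"
    using integral_powr_interpolation(1)[OF ia ab0(1) ib ab0(2) \<theta>(1,2)] by (simp add: in_Lp_def hr)
  have nf: "Lp_norm 2 f = (LINT x|lborel. (norm (G x))\<^sup>2) powr (1/2)" by (simp add: Lp_norm_def f_def)
  have aB: "(LINT x|lborel. a x) \<le> (LINT x|lborel. indicator W x * (v x)\<^sup>2)"
    using w0 wv by (intro integral_mono ia B) (auto simp: a_def indicator_def abs_le_square_iff[symmetric] intro: order_trans)
  let ?A = "LINT x|lborel. (norm (G x))\<^sup>2" and ?B = "LINT x|lborel. indicator W x * (v x)\<^sup>2"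
  have nh: "Lp_norm r h \<le> ?B powr (1/n) * X powr (1/2)"
  proof -
    have "Lp_norm r h \<le> ((LINT x|lborel. a x) powr \<theta> * X powr (1 - \<theta>)) powr (1 / r)"
      unfolding Lp_norm_def hr X_def using r ab0
      by (intro powr_mono2 integral_powr_interpolation(2)[OF ia ab0(1) ib ab0(2) \<theta>(1,2)]) auto
    also have "\<dots> = (LINT x|lborel. a x) powr (\<theta> * (1 / r)) * X powr ((1 - \<theta>) * (1 / r))"
      using ab0 X0 by (simp add: powr_mult powr_powr)
    also have "\<theta> * (1 / r) = 1 / n" using n by (simp add: r1 \<theta>_def divide_simps)
    also have "(1 - \<theta>) * (1 / r) = 1 / 2" unfolding \<theta>(3) using n by (simp add: r1 divide_simps)
    also have "(LINT x|lborel. a x) powr (1 / n) * X powr (1/2) \<le> ?B powr (1/n) * X powr (1/2)"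
      using n aB ab0 by (intro mult_right_mono powr_mono2) auto
    finally show ?thesis .
  qed
  have hls: "(\<integral>\<^sup>+x. \<integral>\<^sup>+y. ennreal \<bar>f x * norm (x - y) powr (- (n - 1)) * h y\<bar> \<partial>lborel \<partial>lborel)
      \<le> ennreal (C_HLS TYPE('a) (n - 1) 2 * Lp_norm 2 f * Lp_norm r h)"
    using n r fL hL by (intro C_HLS_inequality) (auto simp: n_def[symmetric] r1 divide_simps)
  have "ennreal X = (\<integral>\<^sup>+x. ennreal (b x) \<partial>lborel)"
    unfolding X_def using ib ab0 by (intro nn_integral_eq_integral[symmetric]) auto
  also have "\<dots> \<le> (\<integral>\<^sup>+x. indicator W x * ennreal (h x) * ennreal \<bar>v x\<bar> \<partial>lborel)"
  proof (rule nn_integral_mono)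
    fix x
    \<comment> \<open>One factor w is enlarged to |v|, the quantity controlled by
      \<open>riesz\<close>; the remaining power 1 + 4/n is the weight h.\<close>
    have "w x powr (2 + 4 / n) = w x powr (1 + 4 / n) * w x powr 1"
      by (simp only: powr_add[symmetric]) simp
    also have "\<dots> \<le> w x powr (1 + 4 / n) * \<bar>v x\<bar>"
      using w0 wv by (intro mult_left_mono) auto
    finally show "ennreal (b x) \<le> indicator W x * ennreal (h x) * ennreal \<bar>v x\<bar>"
      by (cases "x \<in> W") (auto simp: b_def h_def simp flip: ennreal_mult intro!: ennreal_leI)
  qed
  also have "\<dots> \<le> ennreal E * (\<integral>\<^sup>+x. ennreal (h x) * (\<integral>\<^sup>+w. ennreal (norm (x - w) powr (1 - n) * norm (G w)) \<partial>lborel) \<partial>lborel)"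
    by (rule riesz) measurable
  also have "(\<integral>\<^sup>+x. ennreal (h x) * (\<integral>\<^sup>+w. ennreal (norm (x - w) powr (1 - n) * norm (G w)) \<partial>lborel) \<partial>lborel)
     = (\<integral>\<^sup>+x. \<integral>\<^sup>+w. ennreal \<bar>f w * norm (w - x) powr (- (n - 1)) * h x\<bar> \<partial>lborel \<partial>lborel)"
  proof (rule nn_integral_cong)
    fix x
    have "ennreal (h x) * ennreal (norm (x - w) powr (1 - n) * norm (G w)) = ennreal \<bar>f w * norm (w - x) powr (- (n - 1)) * h x\<bar>" for w
      by (simp add: f_def h_def abs_mult norm_minus_commute mult_ac flip: ennreal_mult)
    then show "ennreal (h x) * (\<integral>\<^sup>+w. ennreal (norm (x - w) powr (1 - n) * norm (G w)) \<partial>lborel)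
       = (\<integral>\<^sup>+w. ennreal \<bar>f w * norm (w - x) powr (- (n - 1)) * h x\<bar> \<partial>lborel)"
      by (subst nn_integral_cmult[symmetric]) auto
  qed
  also have "\<dots> = (\<integral>\<^sup>+w. \<integral>\<^sup>+x. ennreal \<bar>f w * norm (w - x) powr (- (n - 1)) * h x\<bar> \<partial>lborel \<partial>lborel)"
    by (rule lborel_pair.Fubini') measurable
  also have "ennreal E * \<dots> \<le> ennreal E * ennreal (C_HLS TYPE('a) (n - 1) 2 * Lp_norm 2 f * Lp_norm r h)"
    by (rule mult_left_mono[OF hls]) simp
  also have "\<dots> = ennreal (C * (Lp_norm 2 f * Lp_norm r h))"
    using E by (simp add: C_def mult_ac ennreal_mult'[symmetric])
  finally have le: "ennreal X \<le> ennreal (C * (Lp_norm 2 f * Lp_norm r h))" .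
  \<comment> \<open>No sign of C is presupposed: if C \<le> 0, the estimate forces X = 0. If C > 0
    and X > 0, finiteness of X permits cancelling X^(1/2) before squaring.\<close>
  have Xle: "X \<le> (if 0 < C then C\<^sup>2 * ?A * ?B powr (2 / n) else 0)"
  proof (cases "0 < C")
    case False
    then have "C * (Lp_norm 2 f * Lp_norm r h) \<le> 0"
      by (intro mult_nonpos_nonneg) (auto simp: Lp_norm_def)
    then have "ennreal X \<le> 0" using le by (simp add: ennreal_neg)
    then show ?thesis using False X0 by simp
  next
    case True
    have "C * (Lp_norm 2 f * Lp_norm r h) \<le> C * (?A powr (1/2) * (?B powr (1/n) * X powr (1/2)))"
      unfolding nf using True nh by (intro mult_left_mono) auto
    moreover have "0 \<le> C * (Lp_norm 2 f * Lp_norm r h)" using True by (simp add: Lp_norm_def)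
    ultimately have X1: "X \<le> (C * ?A powr (1/2) * ?B powr (1/n)) * X powr (1/2)"
      using le by (simp add: mult_ac)
    have "X \<le> C\<^sup>2 * ?A * ?B powr (2 / n)"
    proof (cases "X = 0")
      case True
      then show ?thesis by simp
    next
      case False
      then have Xp: "0 < X" using X0 by simp
      have "X powr (1/2) * X powr (1/2) = X" using Xp by (simp flip: powr_add)
      with X1 have "X powr (1/2) * X powr (1/2) \<le> (C * ?A powr (1/2) * ?B powr (1/n)) * X powr (1/2)" by simp
      then have "X powr (1/2) \<le> C * ?A powr (1/2) * ?B powr (1/n)"
        using Xp by (simp add: mult_le_cancel_right)
      then have "(X powr (1/2))\<^sup>2 \<le> (C * ?A powr (1/2) * ?B powr (1/n))\<^sup>2"
        by (intro power_mono) auto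
      also have "\<dots> = C\<^sup>2 * (?A powr (1/2) * ?A powr (1/2)) * (?B powr (1/n) * ?B powr (1/n))"
        by (simp add: power2_eq_square)
      also have "?A powr (1/2) * ?A powr (1/2) = ?A" by (simp flip: powr_add)
      also have "?B powr (1/n) * ?B powr (1/n) = ?B powr (2/n)" by (simp flip: powr_add)
      also have "(X powr (1/2))\<^sup>2 = X" using Xp by (simp add: power2_eq_square flip: powr_add)
      finally show ?thesis .
    qed
    then show ?thesis using True by simp
  qed
  have "(\<integral>\<^sup>+x. indicator W x * ennreal (min \<bar>v x\<bar> (real k) powr (2 + 4 / n)) \<partial>lborel) = (\<integral>\<^sup>+x. ennreal (b x) \<partial>lborel)"
    by (intro nn_integral_cong) (auto simp: b_def w_def indicator_def)
  also have "\<dots> = ennreal X"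
    unfolding X_def using ib ab0 by (intro nn_integral_eq_integral) auto
  finally show ?thesis using Xle by (simp add: ennreal_leI)
qed

text \<open>Expanding the square with c the mean leaves the integral of u^2 minus c^2 |W|. This
  allows the norm of u - c on the right to be replaced by that of u.\<close>

lemma integral_deviation_square_le:
  fixes u :: "'a::euclidean_space \<Rightarrow> real"
  assumes W: "W \<in> sets borel" "bounded W" "0 < measure lborel W"
    and u: "integrable lborel (\<lambda>x. indicator W x * u x)" "integrable lborel (\<lambda>x. indicator W x * (u x)\<^sup>2)"
  defines "c \<equiv> (LINT y|lborel. indicator W y * u y) / measure lborel W"
  shows "integrable lborel (\<lambda>x. indicator W x * (u x - c)\<^sup>2)"
    and "(LINT x|lborel. indicator W x * (u x - c)\<^sup>2) \<le> (LINT x|lborel. indicator W x * (u x)\<^sup>2)"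
proof -
  have i1: "integrable lborel (indicator W :: 'a \<Rightarrow> real)"
    using emeasure_bounded_finite[OF W(2)] W(1) by (simp add: integrable_indicator_iff)
  have eq: "indicator W x * (u x - c)\<^sup>2 = indicator W x * (u x)\<^sup>2 - 2 * c * (indicator W x * u x) + c\<^sup>2 * indicator W x" for x
    by (simp add: power2_eq_square algebra_simps)
  show "integrable lborel (\<lambda>x. indicator W x * (u x - c)\<^sup>2)"
    unfolding eq using i1 u by auto
  have "(LINT x|lborel. indicator W x * (u x - c)\<^sup>2) = (LINT x|lborel. indicator W x * (u x)\<^sup>2) - 2 * c * (LINT x|lborel. indicator W x * u x) + c\<^sup>2 * measure lborel W"
    unfolding eq using i1 u by simp
  also have "(LINT x|lborel. indicator W x * u x) = c * measure lborel W" using W(3) by (simp add: c_def)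
  also have "(LINT x|lborel. indicator W x * (u x)\<^sup>2) - 2 * c * (c * measure lborel W) + c\<^sup>2 * measure lborel W
     = (LINT x|lborel. indicator W x * (u x)\<^sup>2) - c\<^sup>2 * measure lborel W" by (simp add: power2_eq_square)
  finally show "(LINT x|lborel. indicator W x * (u x - c)\<^sup>2) \<le> (LINT x|lborel. indicator W x * (u x)\<^sup>2)" by simp
qed

section \<open>Removing the truncation and treating degenerate integrals\<close>

lemma gagliardo_nirenberg_borel:
  fixes u :: "'a::euclidean_space \<Rightarrow> real" and G :: "'a \<Rightarrow> 'a"
  defines "n \<equiv> real DIM('a)"
  assumes n: "3 \<le> n" and W: "open W" "convex W" "bounded W" "W \<noteq> {}"
    and u: "integrable lborel u" and G: "integrable lborel G"
    and weak: "\<And>\<phi> i. test_fun W \<phi> \<Longrightarrow> i \<in> Basis \<Longrightarrow>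
       (LINT x|lborel. u x * frechet_derivative \<phi> (at x) i) = - (LINT x|lborel. (G x \<bullet> i) * \<phi> x)"
    and D: "0 < D" "\<And>x z. x \<in> W \<Longrightarrow> z \<in> W \<Longrightarrow> norm (x - z) \<le> D"
  defines "m \<equiv> measure lborel W"
  defines "c \<equiv> (LINT y|lborel. indicator W y * u y) / m"
  defines "C \<equiv> D ^ DIM('a) / (n * m) * C_HLS TYPE('a) (n - 1) 2"
  shows "ennreal (C powr (- 2)) * (\<integral>\<^sup>+x. indicator W x * ennreal (\<bar>u x - c\<bar> powr (2 + 4 / n)) \<partial>lborel)
    \<le> (\<integral>\<^sup>+x. ennreal ((norm (G x))\<^sup>2) \<partial>lborel) * ennpow (\<integral>\<^sup>+x. indicator W x * ennreal ((u x)\<^sup>2) \<partial>lborel) (2 / n)"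
    (is "_ * ?X \<le> ?A * ennpow ?B _")
proof -
  have [measurable]: "u \<in> borel_measurable borel" "G \<in> borel_measurable borel" "W \<in> sets borel"
    using u G W by auto
  have q: "0 < 2 + 4 / n" using n by (simp add: add_pos_pos)
  have fin: "emeasure lborel W < \<infinity>" using emeasure_bounded_finite[OF W(3)] .
  have emW: "emeasure lborel W = ennreal m" using fin by (simp add: m_def emeasure_eq_ennreal_measure less_top)
  have m: "0 < m"
  proof -
    have "emeasure lborel W \<noteq> 0" using W(1,4) open_not_negligible[of W]
      by (auto simp: negligible_iff_emeasure0)
    then show ?thesis using emW by (simp add: m_def zero_less_measure_iff)
  qed
  have riesz: "(\<integral>\<^sup>+x. indicator W x * g x * ennreal \<bar>u x - c\<bar> \<partial>lborel)
     \<le> ennreal (D ^ DIM('a) / (n * m)) *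
        (\<integral>\<^sup>+x. g x * (\<integral>\<^sup>+w. ennreal (norm (x - w) powr (1 - n) * norm (G w)) \<partial>lborel) \<partial>lborel)"
    if "g \<in> borel_measurable borel" for g
    unfolding n_def c_def m_def using weak D that
    by (intro mean_deviation_riesz_bound[OF W u G]) auto
  have X0: "?X = 0" if "AE x in lborel. x \<in> W \<longrightarrow> u x = c"
  proof -
    have "?X = integral\<^sup>N lborel (\<lambda>x::'a. 0)"
      by (rule nn_integral_cong_AE, use that in eventually_elim) (auto simp: indicator_def)
    then show ?thesis by simp
  qed
  \<comment> \<open>Because 0 times infinity is 0 in \<open>ennreal\<close>, a vanishing factor on
    the right must be shown to force \<open>?X = 0\<close>: zero gradient makes u equal to c, and
    zero u has mean zero. With one factor infinite and the other nonzero the right side is infinite.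
    The last case is the analytic one.\<close>
  consider "?A = 0" | "?A \<noteq> 0" "?B = 0" | "?A \<noteq> 0" "?B = \<infinity>" | "?A = \<infinity>" "?B \<noteq> 0" "?B \<noteq> \<infinity>"
    | "?A \<noteq> \<infinity>" "?B \<noteq> \<infinity>" by blast
  then show ?thesis
  proof cases
    case 1
    then have "AE w in lborel. G w = 0" by (subst (asm) nn_integral_0_iff_AE) auto
    then have z: "(\<integral>\<^sup>+w. ennreal (norm (x - w) powr (1 - n) * norm (G w)) \<partial>lborel) = 0" for x
      by (subst nn_integral_0_iff_AE) (auto elim!: eventually_mono)
    have "(\<integral>\<^sup>+x. indicator W x * 1 * ennreal \<bar>u x - c\<bar> \<partial>lborel) = 0"
      using riesz[of "\<lambda>_. 1"] by (simp add: z)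
    then have "AE x in lborel. indicator W x * 1 * ennreal \<bar>u x - c\<bar> = 0"
      by (subst (asm) nn_integral_0_iff_AE) auto
    then have "AE x in lborel. x \<in> W \<longrightarrow> u x = c" by eventually_elim auto
    then show ?thesis using X0 by simp
  next
    case 2
    then have "AE x in lborel. indicator W x * ennreal ((u x)\<^sup>2) = 0"
      by (subst (asm) nn_integral_0_iff_AE) auto
    then have ae: "AE x in lborel. x \<in> W \<longrightarrow> u x = 0" by eventually_elim auto
    then have "AE x in lborel. indicator W x * u x = 0" by eventually_elim (auto simp: indicator_def)
    then have "(LINT x|lborel. indicator W x * u x) = 0" by (rule integral_eq_zero_AE)
    then have "c = 0" by (simp add: c_def)
    then show ?thesis using X0 ae by simp
  next
    case 3
    then show ?thesis by (simp add: ennpow_def ennreal_mult_top)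
  next
    case 4
    then have "0 < enn2real ?B" by (simp add: enn2real_positive_iff less_top zero_less_iff_neq_zero)
    then have "ennpow ?B (2 / n) \<noteq> 0" using 4 by (simp add: ennpow_def)
    then show ?thesis using 4 by (simp add: ennreal_top_mult)
  next
    case 5
    have iA: "integrable lborel (\<lambda>x. (norm (G x))\<^sup>2)"
      using 5 by (intro integrableI_nonneg) (auto simp: less_top)
    have Beq: "?B = (\<integral>\<^sup>+x. ennreal (indicator W x * (u x)\<^sup>2) \<partial>lborel)"
      by (intro nn_integral_cong) (auto simp: indicator_def)
    have iB: "integrable lborel (\<lambda>x. indicator W x * (u x)\<^sup>2)"
      using 5 unfolding Beq by (intro integrableI_nonneg) (auto simp: less_top)
    have iu: "integrable lborel (\<lambda>y. indicator W y * u y)"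
      by (rule Bochner_Integration.integrable_bound[OF u]) (auto simp: indicator_def intro!: AE_I2)
    define A where "A = (LINT x|lborel. (norm (G x))\<^sup>2)"
    define B where "B = (LINT x|lborel. indicator W x * (u x)\<^sup>2)"
    have A: "?A = ennreal A" and B: "?B = ennreal B"
      unfolding A_def B_def Beq using iA iB by (auto intro!: nn_integral_eq_integral)
    have nn: "0 \<le> A" "0 \<le> B" by (auto simp: A_def B_def)
    note dev = integral_deviation_square_le[OF _ W(3) m[unfolded m_def] iu iB, folded m_def, folded c_def]
    \<comment> \<open>The value 0 for C \<le> 0 agrees with the truncated bound and makes the final
      multiplication by \<open>C powr (- 2)\<close> harmless; for C > 0 that factor cancels
      C^2.\<close>
    define R where "R = (if 0 < C then C\<^sup>2 * A * B powr (2 / n) else 0)"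
    have Xk: "(\<integral>\<^sup>+x. indicator W x * ennreal (min \<bar>u x - c\<bar> (real k) powr (2 + 4 / n)) \<partial>lborel) \<le> ennreal R" for k
    proof -
      have "(\<integral>\<^sup>+x. indicator W x * ennreal (min \<bar>u x - c\<bar> (real k) powr (2 + 4 / n)) \<partial>lborel)
        \<le> ennreal (if 0 < C then C\<^sup>2 * A * (LINT x|lborel. indicator W x * (u x - c)\<^sup>2) powr (2 / n) else 0)"
        unfolding C_def A_def n_def
        by (rule truncated_deviation_bound)
           (use n W D m dev iA riesz in \<open>auto simp: n_def\<close>)
      also have "\<dots> \<le> ennreal R"
        unfolding R_def B_def using dev nn n by (auto intro!: ennreal_leI mult_left_mono powr_mono2)
      finally show ?thesis .
    qed
    \<comment> \<open>Monotone convergence: the truncations increase with k, and at each point the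
      cut-off is eventually inactive.\<close>
    have "(\<lambda>k. \<integral>\<^sup>+x. indicator W x * ennreal (min \<bar>u x - c\<bar> (real k) powr (2 + 4 / n)) \<partial>lborel) \<longlonglongrightarrow> ?X"
    proof (rule nn_integral_LIMSEQ)
      show "incseq (\<lambda>k x. indicator W x * ennreal (min \<bar>u x - c\<bar> (real k) powr (2 + 4 / n)))"
        using q by (intro incseq_SucI le_funI mult_left_mono ennreal_leI powr_mono2) auto
      show "(\<lambda>k. indicator W x * ennreal (min \<bar>u x - c\<bar> (real k) powr (2 + 4 / n)))
         \<longlonglongrightarrow> indicator W x * ennreal (\<bar>u x - c\<bar> powr (2 + 4 / n))" for x
      proof (rule tendsto_eventually)
        obtain N :: nat where "\<bar>u x - c\<bar> \<le> real N" using real_arch_simple by blast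
        then show "\<forall>\<^sub>F k in sequentially. indicator W x * ennreal (min \<bar>u x - c\<bar> (real k) powr (2 + 4 / n))
           = indicator W x * ennreal (\<bar>u x - c\<bar> powr (2 + 4 / n))"
          by (intro eventually_sequentiallyI[of N]) (simp add: min_absorb1)
      qed
    qed measurable
    then have XR: "?X \<le> ennreal R" using Xk by (intro LIMSEQ_le_const2) auto
    have "ennreal (C powr (- 2)) * ?X \<le> ennreal (C powr (- 2)) * ennreal R"
      using XR by (rule mult_left_mono) simp
    also have "\<dots> = ennreal (C powr (- 2) * R)"
      using nn by (simp add: R_def flip: ennreal_mult)
    also have "\<dots> \<le> ennreal (A * B powr (2 / n))"
    proof (rule ennreal_leI, cases "0 < C")
      case True
      then have "C powr (- 2) * C\<^sup>2 = 1" by (simp add: powr_minus powr_numeral)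
      then show "C powr (- 2) * R \<le> A * B powr (2 / n)"
        using True by (simp add: R_def flip: mult.assoc)
    qed (use nn in \<open>simp add: R_def\<close>)
    also have "\<dots> = ?A * ennpow ?B (2 / n)"
      unfolding A B using nn by (simp add: ennpow_def ennreal_mult)
    finally show ?thesis .
  qed
qed

section \<open>From Lebesgue measurable data on a convex set to Borel data\<close>

text \<open>The definition of W11 uses the completed measure, whereas Fubini and the substitutions
  above work with Borel functions on the whole space. Extending by zero and choosing Borel versions,
  componentwise for the gradient, changes the functions only on null sets, which no integral in the
  weak identity sees.\<close>

lemma W11_borel_representative:
  fixes \<Omega> :: "'a::euclidean_space set" and u :: "'a \<Rightarrow> real" and G :: "'a \<Rightarrow> 'a"
  assumes W11: "W11_with_grad \<Omega> u G"
  obtains u' G' where "integrable lborel u'" "integrable lborel G'"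
    "AE x in lebesgue. u' x = indicator \<Omega> x * u x"
    "AE x in lebesgue. G' x = indicator \<Omega> x *\<^sub>R G x"
    "\<forall>\<phi>. test_fun (interior \<Omega>) \<phi> \<longrightarrow> (\<forall>i\<in>Basis.
       (LINT x|lborel. u' x * frechet_derivative \<phi> (at x) i) = - (LINT x|lborel. (G' x \<bullet> i) * \<phi> x))"
proof -
  have rep: "\<exists>f'. integrable lborel f' \<and> (AE x in lebesgue. f' x = indicator \<Omega> x * f x)"
    if "set_integrable lebesgue \<Omega> f" for f :: "'a \<Rightarrow> real"
  proof -
    have f: "integrable lebesgue (\<lambda>x. indicator \<Omega> x * f x)" using that by (simp add: set_integrable_def)
    then obtain f' where [measurable]: "f' \<in> borel_measurable lborel" and ae: "AE x in lborel. indicator \<Omega> x * f x = f' x"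
      using completion_ex_borel_measurable_real[of "\<lambda>x. indicator \<Omega> x * f x" lborel] by blast
    have ae': "AE x in lebesgue. f' x = indicator \<Omega> x * f x"
      using AE_completion[OF ae] by eventually_elim simp
    have "integrable lebesgue f'"
      by (rule integrable_cong_AE_imp[OF f measurable_completion AE_completion[OF ae]]) measurable
    then have "integrable lborel f'" by (simp add: integrable_completion)
    with ae' show ?thesis by blast
  qed
  obtain u' where u': "integrable lborel u'" "AE x in lebesgue. u' x = indicator \<Omega> x * u x"
    using rep W11 unfolding W11_with_grad_def by blast
  have "\<forall>i\<in>Basis. \<exists>f'. integrable lborel f' \<and> (AE x in lebesgue. f' x = indicator \<Omega> x * (G x \<bullet> i))"
    using rep W11 unfolding W11_with_grad_def by blast
  then obtain g where g: "\<And>i. i \<in> Basis \<Longrightarrow> integrable lborel (g i)"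
    "\<And>i. i \<in> Basis \<Longrightarrow> AE x in lebesgue. g i x = indicator \<Omega> x * (G x \<bullet> i)"
    by metis
  define G' where "G' = (\<lambda>x. \<Sum>i\<in>Basis. g i x *\<^sub>R i)"
  have G'i: "G' x \<bullet> i = g i x" if "i \<in> Basis" for x i
    using that by (simp add: G'_def)
  have iG: "integrable lborel G'"
    unfolding G'_def using g(1) by (intro Bochner_Integration.integrable_sum) auto
  have "AE x in lebesgue. \<forall>i\<in>Basis. g i x = indicator \<Omega> x * (G x \<bullet> i)"
    using g(2) by (subst AE_ball_countable) (auto simp: countable_finite)
  then have aeG: "AE x in lebesgue. G' x = indicator \<Omega> x *\<^sub>R G x"
    by eventually_elim (rule euclidean_eqI, simp add: G'i)
  show ?thesis
  proof (rule that[OF u'(1) iG u'(2) aeG], intro allI impI ballI)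
    fix \<phi> :: "'a \<Rightarrow> real" and i :: 'a assume \<phi>: "test_fun (interior \<Omega>) \<phi>" and i: "i \<in> Basis"
    have C: "C_k (Suc 0) \<phi>" using \<phi> by (auto simp: test_fun_def smooth_fun_def)
    \<comment> \<open>The interior operation is idempotent, so both supports conditions
      coincide.\<close>
    have t: "test_fun \<Omega> \<phi>" using \<phi> by (simp add: test_fun_def)
    have conv: "(LINT x:\<Omega>|lebesgue. f x * p x) = (LINT x|lborel. f' x * p x)"
      if f': "integrable lborel f'" "AE x in lebesgue. f' x = indicator \<Omega> x * f x"
        and p: "continuous_on UNIV p" and f: "set_integrable lebesgue \<Omega> f" for f f' p :: "'a \<Rightarrow> real"
    proof -
      have [measurable]: "f' \<in> borel_measurable lborel" "p \<in> borel_measurable lborel"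
        using f' p by (auto intro: borel_measurable_continuous_onI)
      have fm: "(\<lambda>x. indicator \<Omega> x * f x) \<in> borel_measurable lebesgue"
        using f by (auto simp: set_integrable_def)
      have pm: "p \<in> borel_measurable lebesgue" by (rule measurable_completion) measurable
      have "(LINT x:\<Omega>|lebesgue. f x * p x) = (LINT x|lebesgue. (indicator \<Omega> x * f x) * p x)"
        by (simp add: set_lebesgue_integral_def mult.assoc)
      also have "\<dots> = (LINT x|lebesgue. f' x * p x)"
      proof (rule integral_cong_AE)
        show "AE x in lebesgue. (indicator \<Omega> x * f x) * p x = f' x * p x"
          using f'(2) by eventually_elim simp
        show "(\<lambda>x. (indicator \<Omega> x * f x) * p x) \<in> borel_measurable lebesgue"
          using fm pm by (rule borel_measurable_times)
        show "(\<lambda>x. f' x * p x) \<in> borel_measurable lebesgue"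
          by (rule measurable_completion) measurable
      qed
      also have "\<dots> = (LINT x|lborel. f' x * p x)" by (rule integral_completion) measurable
      finally show ?thesis .
    qed
    have "(LINT x|lborel. u' x * frechet_derivative \<phi> (at x) i) = (LINT x:\<Omega>|lebesgue. u x * frechet_derivative \<phi> (at x) i)"
      using W11 u' by (intro conv[symmetric] frechet_derivative_C_k[OF C]) (auto simp: W11_with_grad_def)
    also have "\<dots> = - (LINT x:\<Omega>|lebesgue. (G x \<bullet> i) * \<phi> x)"
      using W11 t i by (auto simp: W11_with_grad_def)
    also have "(LINT x:\<Omega>|lebesgue. (G x \<bullet> i) * \<phi> x) = (LINT x|lborel. g i x * \<phi> x)"
      using W11 g i by (intro conv C_k_continuous[OF C]) (auto simp: W11_with_grad_def)
    finally show "(LINT x|lborel. u' x * frechet_derivative \<phi> (at x) i) = - (LINT x|lborel. (G' x \<bullet> i) * \<phi> x)"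
      using i by (simp add: G'i)
  qed
qed

theorem theorem2p1:
  fixes \<Omega> :: "'a::euclidean_space set" and u :: "'a \<Rightarrow> real" and G :: "'a \<Rightarrow> 'a"
  assumes "DIM('a) \<ge> 3"
    and "bounded \<Omega>" and "convex \<Omega>"
    and "W11_with_grad \<Omega> u G"
  shows "(\<integral>\<^sup>+ x\<in>\<Omega>. ennreal ((norm (G x))\<^sup>2) \<partial>lebesgue)
           * ennpow (\<integral>\<^sup>+ x\<in>\<Omega>. ennreal ((u x)\<^sup>2) \<partial>lebesgue) (2 / real DIM('a))
         \<ge> ennreal (C_1 \<Omega>) *
           (\<integral>\<^sup>+ x\<in>\<Omega>. ennreal (\<bar>u x - (LINT y:\<Omega>|lebesgue. u y) / measure lebesgue \<Omega>\<bar>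
                                 powr (2 + 4 / real DIM('a))) \<partial>lebesgue)"
proof -
  define W where "W = interior \<Omega>"
  have W: "open W" "convex W" "bounded W" "W \<subseteq> \<Omega>"
    unfolding W_def using assms(2,3) interior_subset by (auto intro: convex_interior bounded_interior)
  have [measurable]: "W \<in> sets borel" using W by auto
  \<comment> \<open>The frontier of a convex set is a null set, so every integral over
    \<open>\<Omega>\<close> may be taken over its open interior W.\<close>
  have "negligible (\<Omega> - W)"
    by (rule negligible_subset[OF negligible_convex_frontier[OF assms(3)]])
       (use closure_subset[of \<Omega>] in \<open>auto simp: W_def frontier_def\<close>)
  then have "AE x in lebesgue. x \<notin> \<Omega> - W"
    by (intro AE_not_in) (simp add: negligible_iff_null_sets)
  then have aeW: "AE x in lebesgue. x \<in> \<Omega> \<longleftrightarrow> x \<in> W"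
    by eventually_elim (use W(4) in auto)
  obtain u' G' where u': "integrable lborel u'" and G': "integrable lborel G'"
    and u'_eq: "AE x in lebesgue. u' x = indicator \<Omega> x * u x"
    and G'_eq: "AE x in lebesgue. G' x = indicator \<Omega> x *\<^sub>R G x"
    and weak: "\<forall>\<phi>. test_fun W \<phi> \<longrightarrow> (\<forall>i\<in>Basis.
       (LINT x|lborel. u' x * frechet_derivative \<phi> (at x) i) = - (LINT x|lborel. (G' x \<bullet> i) * \<phi> x))"
    by (rule W11_borel_representative[OF assms(4), folded W_def]) (rule that)
    have [measurable]: "u' \<in> borel_measurable lborel" "G' \<in> borel_measurable lborel" using u' G' by auto
  have nnu: "(\<integral>\<^sup>+x\<in>\<Omega>. f (u x) \<partial>lebesgue) = (\<integral>\<^sup>+x. indicator W x * f (u' x) \<partial>lborel)" for f :: "real \<Rightarrow> ennreal"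
  proof -
    have "(\<integral>\<^sup>+x\<in>\<Omega>. f (u x) \<partial>lebesgue) = (\<integral>\<^sup>+x. indicator W x * f (u' x) \<partial>lebesgue)"
      by (rule nn_integral_cong_AE, use aeW u'_eq in eventually_elim) (auto simp: indicator_def)
    then show ?thesis by (simp add: nn_integral_completion)
  qed
  have nnG: "(\<integral>\<^sup>+x\<in>\<Omega>. ennreal ((norm (G x))\<^sup>2) \<partial>lebesgue) = (\<integral>\<^sup>+x. ennreal ((norm (G' x))\<^sup>2) \<partial>lborel)"
  proof -
    have "(\<integral>\<^sup>+x\<in>\<Omega>. ennreal ((norm (G x))\<^sup>2) \<partial>lebesgue) = (\<integral>\<^sup>+x. ennreal ((norm (G' x))\<^sup>2) \<partial>lebesgue)"
      by (rule nn_integral_cong_AE, use G'_eq in eventually_elim) (auto simp: indicator_def)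
    then show ?thesis by (simp add: nn_integral_completion)
  qed
  show ?thesis
  proof (cases "W = {}")
    \<comment> \<open>With empty interior \<open>\<Omega>\<close> is itself null, so the integral of
      the deviation is 0.\<close>
    case True
    then show ?thesis
      unfolding nnu[of "\<lambda>t. ennreal (\<bar>t - (LINT y:\<Omega>|lebesgue. u y) / measure lebesgue \<Omega>\<bar> powr (2 + 4 / real DIM('a)))"]
      by simp
  next
    case False
    have meas: "measure lebesgue \<Omega> = measure lborel W"
    proof -
      have "measure lebesgue \<Omega> = measure lebesgue W"
      proof (rule measure_negligible_symdiff)
        have "(W - \<Omega>) \<union> (\<Omega> - W) = \<Omega> - W" using W(4) by blast
        then show "negligible ((W - \<Omega>) \<union> (\<Omega> - W))" using \<open>negligible (\<Omega> - W)\<close> by simp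
      qed (rule lmeasurable_open[OF W(3,1)])
      then show ?thesis by simp
    qed
    have avg: "(LINT y:\<Omega>|lebesgue. u y) = (LINT y|lborel. indicator W y * u' y)"
    proof -
      have um: "(\<lambda>x. indicator \<Omega> x *\<^sub>R u x) \<in> borel_measurable lebesgue"
        using assms(4) by (auto simp: W11_with_grad_def set_integrable_def)
      have "(LINT y:\<Omega>|lebesgue. u y) = (LINT y|lebesgue. indicator W y * u' y)"
        unfolding set_lebesgue_integral_def
      proof (rule integral_cong_AE[OF um])
        show "(\<lambda>y. indicator W y * u' y) \<in> borel_measurable lebesgue"
          by (rule measurable_completion) measurable
        show "AE x in lebesgue. indicator \<Omega> x *\<^sub>R u x = indicator W x * u' x"
          using aeW u'_eq by eventually_elim (auto simp: indicator_def)
      qed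
      also have "\<dots> = (LINT y|lborel. indicator W y * u' y)" by (rule integral_completion) measurable
      finally show ?thesis .
    qed
    have dist: "norm (x - z) \<le> diameter \<Omega>" if "x \<in> W" "z \<in> W" for x z
      using diameter_bounded_bound[OF assms(2), of x z] that W(4) by (simp add: dist_norm subset_iff)
    \<comment> \<open>A nonempty open set cannot be a single point, which diameter at most 0 would
      force on W.\<close>
    have D: "0 < diameter \<Omega>"
    proof (rule ccontr)
      assume "\<not> 0 < diameter \<Omega>"
      then have "x = z" if "x \<in> W" "z \<in> W" for x z using order_trans[OF dist[OF that], of 0] by (simp add: not_less)
      with False obtain x where "W = {x}" by blast
      with W(1) show False using not_open_singleton by blast
    qed
    have "ennreal ((diameter \<Omega> ^ DIM('a) / (real DIM('a) * measure lborel W) * C_HLS TYPE('a) (real DIM('a) - 1) 2) powr (- 2)) *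
        (\<integral>\<^sup>+x. indicator W x * ennreal (\<bar>u' x - (LINT y|lborel. indicator W y * u' y) / measure lborel W\<bar> powr (2 + 4 / real DIM('a))) \<partial>lborel)
      \<le> (\<integral>\<^sup>+x. ennreal ((norm (G' x))\<^sup>2) \<partial>lborel) * ennpow (\<integral>\<^sup>+x. indicator W x * ennreal ((u' x)\<^sup>2) \<partial>lborel) (2 / real DIM('a))"
    proof (rule gagliardo_nirenberg_borel[OF _ W(1-3) False u' G'])
      show "3 \<le> real DIM('a)" using assms(1) by simp
    qed (use weak D dist in blast)+
    then show ?thesis
      unfolding nnG nnu[of "\<lambda>t. ennreal (t\<^sup>2)"] avg meas C_1_def C_D_def
        nnu[of "\<lambda>t. ennreal (\<bar>t - (LINT y|lborel. indicator W y * u' y) / measure lborel W\<bar> powr (2 + 4 / real DIM('a)))"] .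
  qed
qed

end
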